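(* Let $\sigma$ and $\tau$ be nonsingular cones in $N_{\mathbb{R}}$, where $N\simeq\mathbb{Z}^n$, and let $v\in\sigma\cap\tau$ be a vector with rationally independent coordinates. Then there exists a nonsingular cone $\rho$ which is obtained from $\sigma$ by a finite sequence of smooth star subdivisions along $v$ and is also obtained from $\tau$ by a finite sequence of smooth star subdivisions along $v$.
   Context: Let $N\simeq\mathbb{Z}^n$ be a lattice and $N_{\mathbb{R}}=N\otimes\mathbb{R}$. A rational polyhedral cone $\sigma=\mathbb{R}_{\ge 0}w_1+\cdots+\mathbb{R}_{\ge 0}w_m$ ($w_i\in N$) is nonsingular if it can be generated by a part of a $\mathbb{Z}$-basis of $N$; a nonsingular $m$-dimensional cone has a unique set of minimal generators $w_1,\ldots,w_m\in N$ forming part of a basis of $N$, and one writes $\sigma=\langle w_1,\ldots,w_m\rangle$. A vector $v\in N_{\mathbb{R}}$ has rationally independent coordinates if its $n$ coordinates with respect to a (equivalently, any) $\mathbb{Z}$-basis of $N$ are linearly independent over $\mathbb{Q}$. (In particular, a rational cone containing such a $v$ is $n$-dimensional.) Smooth star subdivision along $v$: let $\sigma=\langle w_1,\ldots,w_n\rangle$ be a nonsingular $n$-dimensional cone containing a vector $v$ with rationally independent coordinates. For $1\le i<j\le n$, precisely one of the two nonsingular cones $$\langle w_i+w_j, w_1,\ldots,\hat{w}_i,\ldots,w_n\rangle,\qquad \langle w_i+w_j, w_1,\ldots,\hat{w}_j,\ldots,w_n\rangle$$ contains $v$ (the hat means the generator is omitted). That cone is called the (smooth) star subdivision of $\sigma$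 at $w_i+w_j$ along $v$. Sequences of star subdivisions are finite and may be empty; each step is applied to the cone resulting from the previous step. *)

theory Defs
  imports Complex_Main
begin

text \<open>
  The vector space \<open>N\<^sub>\<real>\<close> is the whole type \<^typ>\<open>'a::real_vector\<close>, and the lattice \<open>N\<close> is the subgroup
  generated by some basis of it; \<open>n\<close> is the number of elements of such a basis.  As \<open>N \<otimes> \<real> = N\<^sub>\<real>\<close>,
  the \<open>\<int>\<close>-bases of \<open>N\<close> are exactly the \<open>\<real>\<close>-bases of \<open>N\<^sub>\<real>\<close> whose integral combinations form \<open>N\<close>.
\<close>

definition lattice_basis :: "'a::real_vector set \<Rightarrow> 'a set \<Rightarrow> bool" where
  "lattice_basis N B \<longleftrightarrow>
     finite B \<and> independent B \<and> span B = UNIV \<and>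
     N = {(\<Sum>b\<in>B. of_int (c b) *\<^sub>R b) | c :: 'a \<Rightarrow> int. True}"

definition full_lattice :: "'a::real_vector set \<Rightarrow> bool" where
  "full_lattice N \<longleftrightarrow> (\<exists>B. lattice_basis N B)"

definition cone_spanned_by :: "'a::real_vector set \<Rightarrow> 'a set" where
  "cone_spanned_by W = {(\<Sum>w\<in>W. c w *\<^sub>R w) | c :: 'a \<Rightarrow> real. \<forall>w\<in>W. 0 \<le> c w}"

definition nonsingular_cone :: "'a::real_vector set \<Rightarrow> 'a set \<Rightarrow> bool" where
  "nonsingular_cone N \<sigma> \<longleftrightarrow> (\<exists>B W. lattice_basis N B \<and> W \<subseteq> B \<and> \<sigma> = cone_spanned_by W)"

definition rationally_independent_coords :: "'a::real_vector set \<Rightarrow> 'a \<Rightarrow> bool" where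
  "rationally_independent_coords N v \<longleftrightarrow>
     (\<exists>B. lattice_basis N B \<and>
        (\<forall>q :: 'a \<Rightarrow> rat. (\<Sum>b\<in>B. of_rat (q b) * representation B v b) = 0 \<longrightarrow> (\<forall>b\<in>B. q b = 0)))"

text \<open>
  \<open>star_subdivision N v \<sigma> \<rho>\<close>: the cone \<open>\<rho>\<close> is the smooth star subdivision of \<open>\<sigma>\<close> along \<open>v\<close> at the sum
  of some two of the minimal generators \<open>W\<close> of \<open>\<sigma>\<close>.  The pair \<open>(w, w')\<close> is ordered, \<open>w\<close> being the
  omitted generator, so both candidate cones for an unordered pair are covered and \<open>v \<in> \<rho>\<close> selects
  the right one.
\<close>

definition star_subdivision ::
    "'a::real_vector set \<Rightarrow> 'a \<Rightarrow> 'a set \<Rightarrow> 'a set \<Rightarrow> bool" where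
  "star_subdivision N v \<sigma> \<rho> \<longleftrightarrow>
     (\<exists>W w w'. lattice_basis N W \<and> \<sigma> = cone_spanned_by W \<and> v \<in> \<sigma> \<and>
        w \<in> W \<and> w' \<in> W \<and> w \<noteq> w' \<and>
        \<rho> = cone_spanned_by (insert (w + w') (W - {w})) \<and> v \<in> \<rho>)"

end

theory Submission
  imports Defs
begin

text \<open>
  Let \<open>v\<close> have the coordinates \<open>a\<^sub>1, \<dots>, a\<^sub>n\<close> with respect to the generators of \<open>\<sigma>\<close>.  They are positive
  reals, linearly independent over \<open>\<int>\<close>, and the subgroup of \<open>\<real>\<close> that they generate is the set of values
  at \<open>v\<close> of the integral linear forms, so it is the same for \<open>\<sigma>\<close> and \<open>\<tau>\<close>.  A star subdivision along \<open>v\<close>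
  subtracts a coordinate from a larger one, and by independence a basis is determined by the set of
  coordinates of \<open>v\<close>.  The claim thus becomes: two positive bases \<open>A\<close> and \<open>B\<close> of a subgroup of \<open>\<real>\<close> can be
  transformed into the same set by subtracting elements from larger ones (\<open>common_subtraction\<close>).

  This is shown by induction on the rank.  In rank one \<open>A = B\<close>, and in rank two it is the Euclidean algorithm.  In higher rank,
  let \<open>w\<close> be a generator of \<open>\<tau>\<close>, \<open>s \<in> B\<close> the corresponding coordinate of \<open>v\<close>, and \<open>f\<close> the functional
  that takes the value \<open>1\<close> at \<open>s\<close> and \<open>0\<close> on the rest of \<open>B\<close>.  The vector \<open>w\<close> need not be close to \<open>v\<close>, so
  it cannot be expected to become a generator of a subdivision of \<open>\<sigma>\<close>.  But in rank at least three it can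
  always be made a \<^emph>\<open>difference\<close> of two generators (\<open>eventually_splits\<close>): \<open>A\<close> can be transformed such
  that \<open>f\<close> takes the values \<open>1\<close> at some \<open>q\<close>, \<open>-1\<close> at some \<open>p\<close>, and \<open>0\<close> elsewhere.  Before that, \<open>A\<close> is
  transformed such that \<open>s\<close> is a combination of \<open>A\<close> with coefficients in \<open>\<nat>\<close>
  (\<open>eventually_in_nat_span\<close>), and this remains true under all further steps.

  Modulo \<open>w\<close> the two generators coincide.  Accordingly, replacing \<open>p\<close> and \<open>q\<close> by \<open>p + q\<close> yields a basis
  \<open>Y\<close> of the kernel of \<open>f\<close>, and another one is \<open>B - {s}\<close>.  By induction they have a common descendant.
  The steps on \<open>B - {s}\<close> are steps on \<open>B\<close>, and those on \<open>Y\<close> can be lifted such that an element of the kernel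
  basis remains broken into two parts \<open>q\<close> and \<open>p\<close> (\<open>lift_subtractions\<close>).  So let \<open>Y = B - {s}\<close>.
  Since \<open>f s = 1 = f q\<close> and \<open>s\<close> is a combination of \<open>A\<close> with coefficients in \<open>\<nat>\<close>, the difference \<open>s - q\<close> is
  one of \<open>Y\<close>.  Hence subtracting elements of \<open>Y\<close> from \<open>s\<close> turns \<open>B = {s} \<union> Y\<close> into \<open>{q} \<union> Y\<close>, and
  subtracting \<open>q\<close> from the broken element \<open>p + q\<close> of \<open>Y\<close> turns this into \<open>A\<close>.
\<close>

section \<open>Subtractions in positive independent families\<close>

text \<open>
  \<open>a i\<close> is the coordinate of \<open>v\<close> along the \<open>i\<close>-th generator of a cone.  As
  \<open>a\<^sub>i w\<^sub>i + a\<^sub>j w\<^sub>j = (a\<^sub>i - a\<^sub>j) w\<^sub>i + a\<^sub>j (w\<^sub>i + w\<^sub>j)\<close>, the subdivision at \<open>w\<^sub>i + w\<^sub>j\<close> along \<open>v\<close> replaces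
  \<open>w\<^sub>j\<close> by \<open>w\<^sub>i + w\<^sub>j\<close> and \<open>a\<^sub>i\<close> by \<open>a\<^sub>i - a\<^sub>j\<close> if \<open>a\<^sub>j < a\<^sub>i\<close>.  The index set stays fixed, so that the
  members before and after a step correspond to each other.
\<close>
definition subtraction :: "'i set \<Rightarrow> ('i \<Rightarrow> real) \<Rightarrow> ('i \<Rightarrow> real) \<Rightarrow> bool" where
  "subtraction I a a' \<longleftrightarrow> (\<exists>i\<in>I. \<exists>j\<in>I. a j < a i \<and> a' = a(i := a i - a j))"

abbreviation subtractions :: "'i set \<Rightarrow> ('i \<Rightarrow> real) \<Rightarrow> ('i \<Rightarrow> real) \<Rightarrow> bool" where
  "subtractions I \<equiv> (subtraction I)\<^sup>*\<^sup>*"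

definition int_span :: "'i set \<Rightarrow> ('i \<Rightarrow> real) \<Rightarrow> real set" where
  "int_span I a = {(\<Sum>i\<in>I. of_int (c i) * a i) | c :: 'i \<Rightarrow> int. True}"

definition nat_span :: "'i set \<Rightarrow> ('i \<Rightarrow> real) \<Rightarrow> real set" where
  "nat_span I a = {(\<Sum>i\<in>I. of_nat (c i) * a i) | c :: 'i \<Rightarrow> nat. True}"

definition positive_free :: "'i set \<Rightarrow> ('i \<Rightarrow> real) \<Rightarrow> bool" where
  "positive_free I a \<longleftrightarrow> finite I \<and> (\<forall>i\<in>I. 0 < a i) \<and>
     (\<forall>c :: 'i \<Rightarrow> int. (\<Sum>i\<in>I. of_int (c i) * a i) = 0 \<longrightarrow> (\<forall>i\<in>I. c i = 0))"

lemma subtractionI: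
  assumes "i \<in> I" "j \<in> I" "a j < a i"
  shows "subtraction I a (a(i := a i - a j))"
  using assms unfolding subtraction_def by blast

lemma sum_update:
  fixes F :: "'i \<Rightarrow> 'b \<Rightarrow> 'c::ab_group_add"
  assumes "finite I" "j \<in> I"
  shows "(\<Sum>l\<in>I. F l ((u(j := x)) l)) = (\<Sum>l\<in>I. F l (u l)) - F j (u j) + F j x"
proof -
  have "(\<Sum>l\<in>I. F l ((u(j := x)) l)) = F j x + (\<Sum>l\<in>I-{j}. F l ((u(j := x)) l))"
    using assms by (simp add: sum.remove[of I j])
  also have "(\<Sum>l\<in>I-{j}. F l ((u(j := x)) l)) = (\<Sum>l\<in>I-{j}. F l (u l))"
    by (rule sum.cong) auto
  also have "\<dots> = (\<Sum>l\<in>I. F l (u l)) - F j (u j)"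
    using assms by (simp add: sum.remove[of I j])
  finally show ?thesis by (simp add: algebra_simps)
qed

lemma sum_update_minus:
  fixes a :: "'i \<Rightarrow> real"
  assumes "finite I" "j \<in> I"
  shows "(\<Sum>l\<in>I. (a(j := a j - x)) l) = (\<Sum>l\<in>I. a l) - x"
  using sum_update[OF assms, of "\<lambda>l x. x" a "a j - x"] by simp

text \<open>
  A step on the family is answered by the dual operation on coefficients: it is the coefficient of the
  smaller member \<open>a j\<close> that changes.  The map \<open>h\<close> stands for the embedding of \<open>\<nat>\<close> or \<open>\<int>\<close> into \<open>\<real>\<close>.
\<close>
lemma sum_subtract:
  fixes a :: "'i \<Rightarrow> real" and c :: "'i \<Rightarrow> 'c::plus" and h :: "'c \<Rightarrow> real"
  assumes "finite I" "i \<in> I" "j \<in> I" "i \<noteq> j" and h: "\<And>x y. h (x + y) = h x + h y"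
  shows "(\<Sum>l\<in>I. h ((c(j := c j + c i)) l) * (a(i := a i - a j)) l) = (\<Sum>l\<in>I. h (c l) * a l)"
proof -
  have "(\<Sum>l\<in>I. h ((c(j := c j + c i)) l) * (a(i := a i - a j)) l)
     = (\<Sum>l\<in>I. h ((c(j := c j + c i)) l) * a l) - h (c i) * a j"
    using assms(4) by (subst sum_update[where F = "\<lambda>l x. h ((c(j := c j + c i)) l) * x"])
      (simp_all add: assms algebra_simps)
  also have "(\<Sum>l\<in>I. h ((c(j := c j + c i)) l) * a l) = (\<Sum>l\<in>I. h (c l) * a l) + h (c i) * a j"
    by (subst sum_update[where F = "\<lambda>l x. h x * a l"]) (simp_all add: assms algebra_simps)
  finally show ?thesis by simp
qed

lemma int_spanI: "(\<Sum>i\<in>I. of_int (c i) * a i) \<in> int_span I a"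
  unfolding int_span_def by blast

lemma nat_spanI: "(\<Sum>i\<in>I. of_nat (c i) * a i) \<in> nat_span I a"
  unfolding nat_span_def by blast

lemma int_span_base:
  assumes "finite I" "i \<in> I"
  shows "a i \<in> int_span I a"
proof -
  have "(\<Sum>l\<in>I. of_int (if l = i then 1 else 0) * a l) = (\<Sum>l\<in>I. if l = i then a l else 0)"
    by (rule sum.cong) auto
  then have "(\<Sum>l\<in>I. of_int (if l = i then 1 else 0) * a l) = a i"
    using assms by simp
  then show ?thesis using int_spanI[of "\<lambda>l. if l = i then 1 else 0" a I] by simp
qed

lemma int_span_diff:
  assumes "x \<in> int_span I a" "y \<in> int_span I a"
  shows "x - y \<in> int_span I a"
proof -
  obtain c d where "x = (\<Sum>i\<in>I. of_int (c i) * a i)" "y = (\<Sum>i\<in>I. of_int (d i) * a i)"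
    using assms unfolding int_span_def by blast
  then have "x - y = (\<Sum>i\<in>I. of_int (c i - d i) * a i)"
    by (simp add: sum_subtractf algebra_simps)
  then show ?thesis using int_spanI[of "\<lambda>i. c i - d i" a I] by simp
qed

lemma int_span_0: "0 \<in> int_span I a"
  using int_spanI[of "\<lambda>i. 0" a I] by simp

lemma int_span_add:
  assumes "x \<in> int_span I a" "y \<in> int_span I a"
  shows "x + y \<in> int_span I a"
  using int_span_diff[OF assms(1) int_span_diff[OF int_span_0 assms(2)]] by simp

text \<open>
  The growth of the monoid \<open>nat_span\<close> is the shrinking of the cone, seen on linear forms: a form that is
  nonnegative on a cone stays so on every subdivision.
\<close>
lemma subtraction_preserves:
  assumes "positive_free I a" "subtraction I a a'"
  shows "positive_free I a'" "int_span I a' = int_span I a" "nat_span I a \<subseteq> nat_span I a'"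
proof -
  obtain i j where ij: "i \<in> I" "j \<in> I" "a j < a i" and a': "a' = a(i := a i - a j)"
    using assms(2) unfolding subtraction_def by blast
  have fin: "finite I" and pos: "\<And>i. i \<in> I \<Longrightarrow> 0 < a i"
    and ind: "\<And>c :: 'a \<Rightarrow> int. (\<Sum>i\<in>I. of_int (c i) * a i) = 0 \<Longrightarrow> \<forall>i\<in>I. c i = 0"
    using assms(1) unfolding positive_free_def by auto
  have ne: "i \<noteq> j" using ij by auto
  have to: "(\<Sum>l\<in>I. of_int ((c(j := c j + c i)) l) * a' l) = (\<Sum>l\<in>I. of_int (c l) * a l)"
    for c :: "'a \<Rightarrow> int"
    unfolding a' by (rule sum_subtract[where h = "of_int :: int \<Rightarrow> real"]) (simp_all add: fin ij ne)
  have from': "(\<Sum>l\<in>I. of_int (c l) * a' l) = (\<Sum>l\<in>I. of_int ((c(j := c j - c i)) l) * a l)"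
    for c :: "'a \<Rightarrow> int"
    using to[of "c(j := c j - c i)"] ne by simp
  show "positive_free I a'"
    unfolding positive_free_def
  proof (intro conjI allI impI)
    show "finite I" by (rule fin)
    show "\<forall>i\<in>I. 0 < a' i" using pos ij a' by auto
    fix c :: "'a \<Rightarrow> int"
    assume "(\<Sum>i\<in>I. of_int (c i) * a' i) = 0"
    then have "\<forall>l\<in>I. (c(j := c j - c i)) l = 0" using from' ind by metis
    then show "\<forall>l\<in>I. c l = 0" using ne ij by (metis diff_zero fun_upd_apply)
  qed
  show "int_span I a' = int_span I a"
    unfolding int_span_def using to from' by (auto; metis)
  show "nat_span I a \<subseteq> nat_span I a'"
  proof
    fix x assume "x \<in> nat_span I a"
    then obtain c :: "'a \<Rightarrow> nat" where x: "x = (\<Sum>i\<in>I. of_nat (c i) * a i)"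
      unfolding nat_span_def by blast
    have "(\<Sum>l\<in>I. of_nat ((c(j := c j + c i)) l) * a' l) = x"
      unfolding a' x by (rule sum_subtract[where h = "of_nat :: nat \<Rightarrow> real"]) (simp_all add: fin ij ne)
    then show "x \<in> nat_span I a'" using nat_spanI by blast
  qed
qed

lemma subtractions_preserve:
  assumes "subtractions I a a'" "positive_free I a"
  shows "positive_free I a' \<and> int_span I a' = int_span I a \<and> nat_span I a \<subseteq> nat_span I a'"
  using assms
proof (induction rule: rtranclp_induct)
  case (step b c)
  then show ?case using subtraction_preserves[of I b c] by blast
qed simp

lemma subtractions_outside:
  assumes "subtractions I a a'" "l \<notin> I"
  shows "a' l = a l"
  using assms by (induction rule: rtranclp_induct) (auto simp: subtraction_def)

lemma subtractions_mono:
  assumes "subtractions I a a'" "I \<subseteq> J"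
  shows "subtractions J a a'"
  using assms(1)
proof (induction rule: rtranclp_induct)
  case (step b c)
  then have "subtraction J b c" using assms(2) unfolding subtraction_def by blast
  with step show ?case by simp
qed simp

lemma positive_free_coeff_unique:
  assumes "positive_free I a" "(\<Sum>i\<in>I. of_int (c i) * a i) = (\<Sum>i\<in>I. of_int (d i) * a i)" "i \<in> I"
  shows "c i = d i"
proof -
  have "(\<Sum>i\<in>I. of_int (c i - d i) * a i) = 0"
    using assms(2) by (simp add: sum_subtractf algebra_simps)
  then have "c i - d i = 0" using assms(1,3) unfolding positive_free_def by meson
  then show ?thesis by simp
qed

lemma positive_free_inj:
  assumes "positive_free I a"
  shows "inj_on a I"
proof (rule inj_onI, rule ccontr)
  fix i j assume ij: "i \<in> I" "j \<in> I" "a i = a j" "i \<noteq> j"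
  have fin: "finite I" using assms unfolding positive_free_def by auto
  let ?c = "\<lambda>l. if l = i then 1 else 0 :: int" and ?d = "\<lambda>l. if l = j then 1 else 0"
  have "(\<Sum>l\<in>I. of_int (?c l) * a l) = (\<Sum>l\<in>I. if l = i then a l else 0)"
    "(\<Sum>l\<in>I. of_int (?d l) * a l) = (\<Sum>l\<in>I. if l = j then a l else 0)"
    by (auto intro!: sum.cong)
  then have "(\<Sum>l\<in>I. of_int (?c l) * a l) = (\<Sum>l\<in>I. of_int (?d l) * a l)"
    using ij fin by simp
  then have "?c i = ?d i" by (rule positive_free_coeff_unique[OF assms _ ij(1)])
  then show False using ij(4) by simp
qed

lemma positive_free_less:
  assumes "positive_free I a" "i \<in> I" "j \<in> I" "i \<noteq> j" "\<not> a j < a i"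
  shows "a i < a j"
  using positive_free_inj[OF assms(1)] assms(2-) by (metis inj_onD linorder_neqE_linordered_idom)

text \<open>
  An additive map \<open>f\<close> on the group generated by the coordinates is the same as a lattice vector, namely
  the one whose \<open>i\<close>-th coordinate is \<open>f (a i)\<close>.
\<close>
definition additive_on :: "real set \<Rightarrow> (real \<Rightarrow> int) \<Rightarrow> bool" where
  "additive_on S f \<longleftrightarrow> (\<forall>x\<in>S. \<forall>y\<in>S. f (x - y) = f x - f y)"

lemma additive_on_sum:
  assumes f: "additive_on (int_span I a) f" and "finite I"
  shows "f (\<Sum>i\<in>I. of_int (c i) * a i) = (\<Sum>i\<in>I. c i * f (a i))"
proof -
  let ?S = "int_span I a"
  have d: "f (x - y) = f x - f y" if "x \<in> ?S" "y \<in> ?S" for x y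
    using f that unfolding additive_on_def by blast
  have z: "f 0 = 0" using d[OF int_span_0 int_span_0] by simp
  have p: "f (x + y) = f x + f y" if "x \<in> ?S" "y \<in> ?S" for x y
    using d[OF that(1) int_span_diff[OF int_span_0 that(2)]] d[OF int_span_0 that(2)] z by simp
  have m: "of_int k * x \<in> ?S \<and> f (of_int k * x) = k * f x" if x: "x \<in> ?S" for k x
  proof (induction k rule: int_induct[where k = 0])
    case base show ?case using z int_span_0 by simp
  next
    case (step1 i)
    then show ?case using p[of "of_int i * x" x] x int_span_add[of "of_int i * x" I a x]
      by (simp add: algebra_simps)
  next
    case (step2 i)
    then show ?case using d[of "of_int i * x" x] x int_span_diff[of "of_int i * x" I a x]
      by (simp add: algebra_simps)
  qed
  have "(\<Sum>i\<in>K. of_int (c i) * a i) \<in> ?S \<and> f (\<Sum>i\<in>K. of_int (c i) * a i) = (\<Sum>i\<in>K. c i * f (a i))"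
    if "K \<subseteq> I" for K
    using finite_subset[OF that \<open>finite I\<close>] that
  proof (induction K rule: finite_induct)
    case empty then show ?case using z int_span_0 by simp
  next
    case (insert k K)
    then have "a k \<in> ?S" using int_span_base[OF \<open>finite I\<close>] by auto
    then show ?case using insert m[of "a k" "c k"] p by (auto intro: int_span_add)
  qed
  then show ?thesis by blast
qed

section \<open>A measure for Euclid-like descent\<close>

text \<open>
  An integer vector gets smaller when the largest absolute value \<open>K\<close> is attained at fewer places.  Here
  \<open>K\<close> need not be attained by the smaller vector \<open>c'\<close>, and is attained by \<open>c\<close> because the count is positive.
\<close>
definition max_count_less :: "'i set \<Rightarrow> (('i \<Rightarrow> int) \<times> ('i \<Rightarrow> int)) set" where
  "max_count_less I = {(c', c). \<exists>K. (\<forall>j\<in>I. \<bar>c' j\<bar> \<le> K) \<and> (\<forall>j\<in>I. \<bar>c j\<bar> \<le> K) \<and>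
     card {j\<in>I. \<bar>c' j\<bar> = K} < card {j\<in>I. \<bar>c j\<bar> = K}}"

lemma wf_max_count_less:
  assumes "finite I"
  shows "wf (max_count_less I)"
proof -
  let ?M = "\<lambda>c :: 'a \<Rightarrow> int. Max ((\<lambda>j. \<bar>c j\<bar>) ` I)"
  have "max_count_less I \<subseteq> measures [\<lambda>c. nat (?M c), \<lambda>c. card {j\<in>I. \<bar>c j\<bar> = ?M c}]"
  proof clarify
    fix c' c assume "(c', c) \<in> max_count_less I"
    then obtain K where K: "\<forall>j\<in>I. \<bar>c' j\<bar> \<le> K" "\<forall>j\<in>I. \<bar>c j\<bar> \<le> K"
      and less: "card {j\<in>I. \<bar>c' j\<bar> = K} < card {j\<in>I. \<bar>c j\<bar> = K}"
      unfolding max_count_less_def by blast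
    from less have "{j\<in>I. \<bar>c j\<bar> = K} \<noteq> {}" by (metis card.empty not_less_zero)
    then obtain i where i: "i \<in> I" "\<bar>c i\<bar> = K" by blast
    have M: "?M c = K" using i K(2) assms by (intro Max_eqI) auto
    have "?M c' \<in> (\<lambda>j. \<bar>c' j\<bar>) ` I" using assms i by (intro Max_in) auto
    then have M': "0 \<le> ?M c'" "?M c' \<le> K" using K(1) by auto
    show "(c', c) \<in> measures [\<lambda>c. nat (?M c), \<lambda>c. card {j\<in>I. \<bar>c j\<bar> = ?M c}]"
    proof (cases "?M c' = K")
      case True then show ?thesis using M less by simp
    next
      case False then show ?thesis using M M' by simp
    qed
  qed
  then show ?thesis using wf_measures wf_subset by blast
qed

lemma max_count_lessI:
  assumes "\<forall>j\<in>I. \<bar>c' j\<bar> \<le> K" "\<forall>j\<in>I. \<bar>c j\<bar> \<le> K"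
    "card {j\<in>I. \<bar>c' j\<bar> = K} < card {j\<in>I. \<bar>c j\<bar> = K}"
  shows "(c', c) \<in> max_count_less I"
  using assms unfolding max_count_less_def by blast

lemma card_max_update_le:
  assumes "finite I" "\<bar>x\<bar> < K"
  shows "card {j\<in>I. \<bar>(c(i := x)) j\<bar> = K} \<le> card {j\<in>I. \<bar>c j :: int\<bar> = K}"
  using assms by (intro card_mono) auto

lemma card_max_update_less:
  assumes "finite I" "\<bar>x\<bar> < K" "i \<in> I" "\<bar>c i\<bar> = K"
  shows "card {j\<in>I. \<bar>(c(i := x)) j\<bar> = K} < card {j\<in>I. \<bar>c j :: int\<bar> = K}"
  using assms by (intro psubset_card_mono) (auto simp: psubset_eq)

section \<open>Making a positive element a nonnegative combination\<close>

text \<open>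
  Let \<open>i\<close> carry the largest coefficient \<open>K > 0\<close> and \<open>j\<close> a negative one.  Comparing \<open>a i\<close> with \<open>a j\<close>, the step
  replaces one of the two coefficients by \<open>K + c j\<close>, whose absolute value is below \<open>K\<close>.  Either this hits \<open>K\<close>
  itself, and the maximum is attained less often, or it turns the negative coefficient nonnegative.
\<close>
lemma reduce_to_common_sign:
  assumes "positive_free I a" "i \<in> I" "c i = K" "0 < K" "\<forall>j\<in>I. \<bar>c j\<bar> \<le> K"
    and "g = (\<Sum>j\<in>I. of_int (c j) * a j)"
  shows "\<exists>a' c'. subtractions I a a' \<and> g = (\<Sum>j\<in>I. of_int (c' j) * a' j) \<and>
     ((\<forall>j\<in>I. 0 \<le> c' j) \<or>
      (\<forall>j\<in>I. \<bar>c' j\<bar> \<le> K) \<and> card {j\<in>I. \<bar>c' j\<bar> = K} < card {j\<in>I. \<bar>c j :: int\<bar> = K})"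
  using assms
proof (induction "\<Sum>j\<in>I. nat (- c j)" arbitrary: a c rule: less_induct)
  case less
  have fin: "finite I" using less.prems unfolding positive_free_def by auto
  show ?case
  proof (cases "\<forall>j\<in>I. 0 \<le> c j")
    case True then show ?thesis using less.prems by blast
  next
    case False
    then obtain j where j: "j \<in> I" "c j < 0" by auto
    then have ne: "i \<noteq> j" using less.prems by auto
    have bound: "- K \<le> c j" using less.prems(5) j by (metis abs_le_iff minus_le_iff)
    show ?thesis
    proof (cases "a j < a i")
      case True
      define a' where "a' = a(i := a i - a j)"
      define c' where "c' = c(j := c j + K)"
      have s: "subtraction I a a'" unfolding a'_def using less.prems(2) j True by (intro subtractionI)
      have g: "g = (\<Sum>l\<in>I. of_int (c' l) * a' l)"
        unfolding a'_def c'_def less.prems(6) less.prems(3)[symmetric]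
        by (rule sum_subtract[symmetric, where h = "of_int :: int \<Rightarrow> real"])
          (simp_all add: fin less.prems j ne)
      have f1: "(\<Sum>l\<in>I. nat (- c' l)) < (\<Sum>l\<in>I. nat (- c l))"
        using less.prems j unfolding c'_def by (intro sum_strict_mono_ex1 fin) auto
      have f2: "positive_free I a'" using s less.prems(1) subtraction_preserves by blast
      have f3: "c' i = K" using ne less.prems unfolding c'_def by simp
      have f4: "\<forall>l\<in>I. \<bar>c' l\<bar> \<le> K" using less.prems j bound unfolding c'_def by auto
      obtain a'' c'' where *: "subtractions I a' a''" "g = (\<Sum>j\<in>I. of_int (c'' j) * a'' j)"
        "(\<forall>j\<in>I. 0 \<le> c'' j) \<or>
         (\<forall>j\<in>I. \<bar>c'' j\<bar> \<le> K) \<and> card {j\<in>I. \<bar>c'' j\<bar> = K} < card {j\<in>I. \<bar>c' j\<bar> = K}"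
        using less.hyps[OF f1 f2 less.prems(2) f3 less.prems(4) f4 g] by blast
      have "card {j\<in>I. \<bar>c' j\<bar> = K} \<le> card {j\<in>I. \<bar>c j\<bar> = K}"
        unfolding c'_def using bound j less.prems(4) by (intro card_max_update_le fin) auto
      moreover have "subtractions I a a''" using s *(1) by simp
      ultimately show ?thesis using *(2,3) by fastforce
    next
      case False
      then have lt: "a i < a j"
        using positive_free_less[OF less.prems(1,2) j(1) ne] by simp
      define a' where "a' = a(j := a j - a i)"
      define c' where "c' = c(i := c i + c j)"
      have s: "subtraction I a a'" unfolding a'_def using less.prems(2) j lt by (intro subtractionI)
      have g: "g = (\<Sum>l\<in>I. of_int (c' l) * a' l)"
        unfolding a'_def c'_def less.prems(6)
        by (rule sum_subtract[symmetric, where h = "of_int :: int \<Rightarrow> real"])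
          (use fin less.prems j ne in auto)
      have small: "\<bar>c i + c j\<bar> < K" using bound j less.prems by auto
      then have "card {l\<in>I. \<bar>c' l\<bar> = K} < card {l\<in>I. \<bar>c l\<bar> = K}"
        unfolding c'_def using less.prems(2,3,4) by (intro card_max_update_less fin) auto
      moreover have "\<forall>l\<in>I. \<bar>c' l\<bar> \<le> K" using small less.prems unfolding c'_def by auto
      ultimately show ?thesis using s g by blast
    qed
  qed
qed

lemma nat_span_intI:
  assumes "g = (\<Sum>j\<in>I. of_int (c j) * a j)" "\<forall>j\<in>I. 0 \<le> c j"
  shows "g \<in> nat_span I a"
proof -
  have "g = (\<Sum>j\<in>I. of_nat (nat (c j)) * a j)"
    unfolding assms(1) using assms(2) by (intro sum.cong) auto
  then show ?thesis using nat_spanI[of "\<lambda>j. nat (c j)" a I] by simp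
qed

lemma common_sign:
  assumes "positive_free I a" "g = (\<Sum>j\<in>I. of_int (c j) * a j)"
  shows "\<exists>a'. subtractions I a a' \<and> (g \<in> nat_span I a' \<or> - g \<in> nat_span I a')"
proof -
  have fin: "finite I" using assms unfolding positive_free_def by auto
  show ?thesis
    using assms
  proof (induction c arbitrary: a rule: wf_induct_rule[OF wf_max_count_less[OF fin]])
    case (1 c a)
    show ?case
    proof (cases "\<forall>j\<in>I. c j = 0")
      case True
      then have "g \<in> nat_span I a" by (intro nat_span_intI[OF "1.prems"(2)]) auto
      then show ?thesis by blast
    next
      case False
      define K where "K = Max ((\<lambda>j. \<bar>c j\<bar>) ` I)"
      have bound: "\<forall>j\<in>I. \<bar>c j\<bar> \<le> K" unfolding K_def using fin by auto
      have "K \<in> (\<lambda>j. \<bar>c j\<bar>) ` I" unfolding K_def using fin False by (intro Max_in) auto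
      then obtain i where i: "i \<in> I" "\<bar>c i\<bar> = K" by auto
      have K: "0 < K" using False bound by (smt (verit))
      consider "c i = K" | "- c i = K" using i by linarith
      then show ?thesis
      proof cases
        case 1
        obtain a' c' where *: "subtractions I a a'" "g = (\<Sum>j\<in>I. of_int (c' j) * a' j)"
          "(\<forall>j\<in>I. 0 \<le> c' j) \<or>
           (\<forall>j\<in>I. \<bar>c' j\<bar> \<le> K) \<and> card {j\<in>I. \<bar>c' j\<bar> = K} < card {j\<in>I. \<bar>c j :: int\<bar> = K}"
          using reduce_to_common_sign[OF "1.prems"(1) i(1) 1 K bound "1.prems"(2)] by blast
        from *(3) show ?thesis
        proof
          assume "\<forall>j\<in>I. 0 \<le> c' j" then show ?thesis using nat_span_intI[OF *(2)] *(1) by blast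
        next
          assume "(\<forall>j\<in>I. \<bar>c' j\<bar> \<le> K) \<and> card {j\<in>I. \<bar>c' j\<bar> = K} < card {j\<in>I. \<bar>c j :: int\<bar> = K}"
          then have "(c', c) \<in> max_count_less I" using bound by (intro max_count_lessI) auto
          moreover have "positive_free I a'" using subtractions_preserve *(1) "1.prems"(1) by blast
          ultimately obtain a'' where "subtractions I a' a''" "g \<in> nat_span I a'' \<or> - g \<in> nat_span I a''"
            using "1.IH" *(2) by blast
          then show ?thesis using *(1) by (meson rtranclp_trans)
        qed
      next
        case 2
        have g: "- g = (\<Sum>j\<in>I. of_int (- c j) * a j)" unfolding "1.prems"(2) by (simp add: sum_negf)
        have "\<forall>j\<in>I. \<bar>- c j\<bar> \<le> K" using bound by simp
        then obtain a' c' where *: "subtractions I a a'" "- g = (\<Sum>j\<in>I. of_int (c' j) * a' j)"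
          "(\<forall>j\<in>I. 0 \<le> c' j) \<or>
           (\<forall>j\<in>I. \<bar>c' j\<bar> \<le> K) \<and> card {j\<in>I. \<bar>c' j\<bar> = K} < card {j\<in>I. \<bar>- c j :: int\<bar> = K}"
          using reduce_to_common_sign[OF "1.prems"(1) i(1) 2 K _ g] by blast
        from *(3) show ?thesis
        proof
          assume "\<forall>j\<in>I. 0 \<le> c' j" then show ?thesis using nat_span_intI[OF *(2)] *(1) by blast
        next
          assume "(\<forall>j\<in>I. \<bar>c' j\<bar> \<le> K) \<and> card {j\<in>I. \<bar>c' j\<bar> = K} < card {j\<in>I. \<bar>- c j :: int\<bar> = K}"
          then have "((\<lambda>j. - c' j), c) \<in> max_count_less I" using bound by (intro max_count_lessI) auto
          moreover have "positive_free I a'" using subtractions_preserve *(1) "1.prems"(1) by blast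
          moreover have "g = (\<Sum>j\<in>I. of_int (- c' j) * a' j)" using *(2) by (simp add: sum_negf)
          ultimately obtain a'' where "subtractions I a' a''" "g \<in> nat_span I a'' \<or> - g \<in> nat_span I a''"
            using "1.IH" by blast
          then show ?thesis using *(1) by (meson rtranclp_trans)
        qed
      qed
    qed
  qed
qed

lemma nat_span_nonneg:
  assumes "positive_free I a" "x \<in> nat_span I a"
  shows "0 \<le> x"
  using assms unfolding nat_span_def positive_free_def by (auto intro!: sum_nonneg mult_nonneg_nonneg simp: less_imp_le)

lemma eventually_in_nat_span:
  assumes "positive_free I a" "g \<in> int_span I a" "0 < g"
  shows "\<exists>a'. subtractions I a a' \<and> g \<in> nat_span I a'"
proof -
  obtain c where "g = (\<Sum>j\<in>I. of_int (c j) * a j)" using assms(2) unfolding int_span_def by blast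
  then obtain a' where a': "subtractions I a a'" "g \<in> nat_span I a' \<or> - g \<in> nat_span I a'"
    using common_sign[OF assms(1)] by blast
  have "positive_free I a'" using subtractions_preserve a'(1) assms(1) by blast
  then have "- g \<notin> nat_span I a'" using nat_span_nonneg assms(3) by fastforce
  then show ?thesis using a' by blast
qed

section \<open>Turning a lattice vector into a difference of two generators\<close>

lemma additive_subtraction:
  assumes "positive_free I a" "additive_on (int_span I a) f" "j \<in> I" "l \<in> I"
  shows "(\<lambda>i. f ((a(j := a j - a l)) i)) = (\<lambda>i. f (a i))(j := f (a j) - f (a l))"
proof -
  have "finite I" using assms(1) unfolding positive_free_def by auto
  then have "a j \<in> int_span I a" "a l \<in> int_span I a" using assms(3,4) int_span_base by metis+
  then have "f (a j - a l) = f (a j) - f (a l)" using assms(2) unfolding additive_on_def by blast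
  then show ?thesis by auto
qed

text \<open>
  Reduction of \<open>a j\<close> modulo \<open>a l\<close>.  It is invisible to every functional that vanishes on \<open>a l\<close>.
\<close>
lemma reduce_below:
  assumes "positive_free I a" "j \<in> I" "l \<in> I" "j \<noteq> l"
  shows "\<exists>a'. subtractions I a a' \<and> a' j < a l \<and> a' j \<le> a j \<and> (\<forall>i. i \<noteq> j \<longrightarrow> a' i = a i) \<and>
     (\<forall>f. additive_on (int_span I a) f \<longrightarrow> f (a l) = 0 \<longrightarrow> f (a' j) = f (a j))"
  using assms(1)
proof (induction "nat \<lfloor>a j / a l\<rfloor>" arbitrary: a rule: less_induct)
  case less
  have pos: "0 < a l" "0 < a j" using less.prems assms unfolding positive_free_def by auto
  show ?case
  proof (cases "a j < a l")
    case True then show ?thesis by blast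
  next
    case False
    then have lt: "a l < a j" using positive_free_less[OF less.prems assms(2-4)] by argo
    define a' where "a' = a(j := a j - a l)"
    have s: "subtraction I a a'" unfolding a'_def using assms lt by (intro subtractionI)
    have p: "positive_free I a'" "int_span I a' = int_span I a"
      using subtraction_preserves[OF less.prems s] by auto
    have "a' j / a' l = a j / a l - 1" using pos assms unfolding a'_def by (simp add: field_simps)
    then have "nat \<lfloor>a' j / a' l\<rfloor> < nat \<lfloor>a j / a l\<rfloor>"
      using lt pos by simp
    then obtain a'' where *: "subtractions I a' a''" "a'' j < a' l" "a'' j \<le> a' j"
      "\<forall>i. i \<noteq> j \<longrightarrow> a'' i = a' i"
      "\<forall>f. additive_on (int_span I a') f \<longrightarrow> f (a' l) = 0 \<longrightarrow> f (a'' j) = f (a' j)"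
      using less.hyps[OF _ p(1)] by blast
    have "f (a'' j) = f (a j)" if f: "additive_on (int_span I a) f" "f (a l) = 0" for f
    proof -
      have "f (a'' j) = f (a' j)" using *(5) f p(2) assms(4) unfolding a'_def by simp
      also have "\<dots> = f (a j) - f (a l)"
        using fun_cong[OF additive_subtraction[OF less.prems f(1) assms(2,3)], of j]
        unfolding a'_def by simp
      finally show ?thesis using f by simp
    qed
    moreover have "subtractions I a a''" using s *(1) by simp
    moreover have "a'' j < a l" "a'' j \<le> a j" "\<forall>i. i \<noteq> j \<longrightarrow> a'' i = a i"
      using *(2-4) assms(4) pos unfolding a'_def by auto
    ultimately show ?thesis by blast
  qed
qed

text \<open>
  In terms of cones, the lattice vector \<open>f\<close> is the difference of the generators \<open>h\<close> and \<open>k\<close>.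
\<close>
definition splits :: "'i set \<Rightarrow> (real \<Rightarrow> int) \<Rightarrow> ('i \<Rightarrow> real) \<Rightarrow> bool" where
  "splits I f a \<longleftrightarrow> (\<exists>h\<in>I. \<exists>k\<in>I. h \<noteq> k \<and> f (a h) = 1 \<and> f (a k) = - 1 \<and>
     (\<forall>i\<in>I - {h, k}. f (a i) = 0))"

text \<open>
  The value \<open>1\<close> expresses that the lattice vector \<open>f\<close> is primitive.
\<close>
lemma int_common_divisor:
  assumes "finite I" "additive_on (int_span I a) f" "x \<in> int_span I a" "f x = 1" "\<forall>i\<in>I. d dvd f (a i)"
    "0 < d"
  shows "d = 1"
proof -
  obtain c where c: "x = (\<Sum>i\<in>I. of_int (c i) * a i)" using assms(3) unfolding int_span_def by blast
  have "f x = (\<Sum>i\<in>I. c i * f (a i))" unfolding c by (rule additive_on_sum[OF assms(2,1)])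
  moreover have "d dvd (\<Sum>i\<in>I. c i * f (a i))" using assms(5) by (intro dvd_sum) auto
  ultimately show ?thesis using assms(4,6) by simp
qed

text \<open>
  Let \<open>i\<close> carry the largest value \<open>K > 0\<close> of \<open>f\<close>.  Subtracting a member from a larger one whose value
  has the same sign yields a value of absolute value below the larger of the two.  The member \<open>r = a i\<close> is
  changed only when its value drops below \<open>K\<close>; until then every subtraction of \<open>r\<close> from another member uses
  up a fixed amount of the total, so only finitely many can occur.  A subtraction between two members with
  negative values makes the sum of all negative values smaller in absolute value.

  What remains is one positive value \<open>K\<close>, at most one negative value \<open>- L\<close>, and zeros.  If \<open>L = K\<close>, then \<open>K = 1\<close>
  by primitivity.  If \<open>L < K\<close>, a third member with value \<open>0\<close> is given the value \<open>L\<close> by subtracting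
  the negative member from it, and the pair \<open>K, L\<close> of equal signs can be treated as before.  This third
  member is the reason for assuming rank at least three: two values \<open>2\<close> and \<open>-1\<close> alone can only grow apart.
\<close>
lemma reduce_to_split:
  fixes f :: "real \<Rightarrow> int"
  assumes card: "3 \<le> card I" and f: "additive_on S f" and x0: "x0 \<in> S" "f x0 = 1"
    and i: "i \<in> I" and K: "0 < K"
    and prems: "positive_free I a" "int_span I a = S" "a i = r" "f (a i) = K" "\<forall>j\<in>I. \<bar>f (a j)\<bar> \<le> K"
  shows "\<exists>a'. subtractions I a a' \<and> (splits I f a' \<or>
     (\<forall>j\<in>I. \<bar>f (a' j)\<bar> \<le> K) \<and> card {j\<in>I. \<bar>f (a' j)\<bar> = K} < card {j\<in>I. \<bar>f (a j)\<bar> = K})"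
  using prems
proof (induction a rule: wf_induct_rule[OF wf_measures[of
    "[\<lambda>a. nat \<lfloor>(\<Sum>j\<in>I. a j) / r\<rfloor>, \<lambda>a. \<Sum>j\<in>I. nat (- f (a j))]"]])
  case (1 a)
  note prems = "1.prems"
  have fin: "finite I" and pos: "\<And>j. j \<in> I \<Longrightarrow> 0 < a j"
    using prems(1) unfolding positive_free_def by auto
  have r: "0 < r" using pos[OF i] prems(3) by simp
  define N where "N b = card {j\<in>I. \<bar>f (b j)\<bar> = K}" for b :: "'a \<Rightarrow> real"
  define good where "good a' \<longleftrightarrow> splits I f a' \<or> (\<forall>j\<in>I. \<bar>f (a' j)\<bar> \<le> K) \<and> N a' < N a" for a'
  \<comment> \<open>the descent may continue from \<open>b\<close> if \<open>r\<close> was used up once or the negative part got smaller\<close>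
  have rec: "\<exists>a'. subtractions I a a' \<and> good a'"
    if b: "subtractions I a b" "b i = r" "f (b i) = K" "\<forall>j\<in>I. \<bar>f (b j)\<bar> \<le> K" "N b \<le> N a"
      "(\<Sum>j\<in>I. b j) \<le> (\<Sum>j\<in>I. a j) - r \<or>
       (\<Sum>j\<in>I. b j) \<le> (\<Sum>j\<in>I. a j) \<and> (\<Sum>j\<in>I. nat (- f (b j))) < (\<Sum>j\<in>I. nat (- f (a j)))" for b
  proof -
    have pb: "positive_free I b" "int_span I b = S" using subtractions_preserve[OF b(1) prems(1)] prems by auto
    have bsum: "r \<le> (\<Sum>j\<in>I. b j)"
      using member_le_sum[OF i, of b] pb(1) b(2) unfolding positive_free_def by (auto simp: less_imp_le)
    have fl: "nat \<lfloor>x / r\<rfloor> \<le> nat \<lfloor>y / r\<rfloor>" if "x \<le> y" for x y :: real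
      using that r by (intro nat_mono floor_mono divide_right_mono) auto
    have less: "nat \<lfloor>(\<Sum>j\<in>I. b j) / r\<rfloor> < nat \<lfloor>(\<Sum>j\<in>I. a j) / r\<rfloor>" if "(\<Sum>j\<in>I. b j) \<le> (\<Sum>j\<in>I. a j) - r"
    proof -
      have "(\<Sum>j\<in>I. b j) / r \<le> (\<Sum>j\<in>I. a j) / r - 1" using that r by (simp add: field_simps)
      then have "\<lfloor>(\<Sum>j\<in>I. b j) / r\<rfloor> \<le> \<lfloor>(\<Sum>j\<in>I. a j) / r\<rfloor> - 1" by linarith
      moreover have "0 < \<lfloor>(\<Sum>j\<in>I. b j) / r\<rfloor>" using bsum r by simp
      ultimately show ?thesis by linarith
    qed
    have "(b, a) \<in> measures [\<lambda>a. nat \<lfloor>(\<Sum>j\<in>I. a j) / r\<rfloor>, \<lambda>a. \<Sum>j\<in>I. nat (- f (a j))]"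
      using b(6)
    proof
      assume *: "(\<Sum>j\<in>I. b j) \<le> (\<Sum>j\<in>I. a j) \<and> (\<Sum>j\<in>I. nat (- f (b j))) < (\<Sum>j\<in>I. nat (- f (a j)))"
      then have "nat \<lfloor>(\<Sum>j\<in>I. b j) / r\<rfloor> \<le> nat \<lfloor>(\<Sum>j\<in>I. a j) / r\<rfloor>" using fl by blast
      then consider "nat \<lfloor>(\<Sum>j\<in>I. b j) / r\<rfloor> < nat \<lfloor>(\<Sum>j\<in>I. a j) / r\<rfloor>"
        | "nat \<lfloor>(\<Sum>j\<in>I. b j) / r\<rfloor> = nat \<lfloor>(\<Sum>j\<in>I. a j) / r\<rfloor>" by linarith
      then show ?thesis using * by cases (simp_all add: in_measures)
    next
      assume "(\<Sum>j\<in>I. b j) \<le> (\<Sum>j\<in>I. a j) - r"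
      from less[OF this] show ?thesis unfolding in_measures by blast
    qed
    then obtain a' where "subtractions I b a'"
      "splits I f a' \<or> (\<forall>j\<in>I. \<bar>f (a' j)\<bar> \<le> K) \<and> N a' < N b"
      using "1.IH"[OF _ pb b(2,3,4)] unfolding N_def by blast
    then show ?thesis using b(1,5) unfolding good_def by (meson order_less_le_trans rtranclp_trans)
  qed
  have S: "additive_on (int_span I a) f" using f prems by simp
  have "\<exists>a'. subtractions I a a' \<and> good a'"
  proof -
    consider (pos) j where "j \<in> I" "j \<noteq> i" "0 < f (a j)"
      | (two) j l where "j \<in> I" "l \<in> I" "j \<noteq> l" "a l < a j" "f (a j) < 0" "f (a l) < 0"
      | (one) j where "j \<in> I" "f (a j) < 0" "\<forall>l\<in>I - {i, j}. f (a l) = 0"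
      | (none) "\<forall>l\<in>I - {i}. f (a l) = 0"
    proof (cases "\<exists>j\<in>I. j \<noteq> i \<and> 0 < f (a j)")
      case True then show ?thesis using pos by blast
    next
      case F: False
      show ?thesis
      proof (cases "\<exists>j\<in>I. f (a j) < 0")
        case True
        then obtain j where j: "j \<in> I" "f (a j) < 0" by blast
        show ?thesis
        proof (cases "\<forall>l\<in>I - {i, j}. f (a l) = 0")
          case True then show ?thesis using j one by blast
        next
          case False
          then obtain l where l: "l \<in> I" "l \<noteq> j" "f (a l) < 0" using F
            by (metis DiffE insertCI linorder_neqE_linordered_idom)
          then show ?thesis using two[OF j(1) l(1)] two[OF l(1) j(1)] j
            positive_free_less[OF prems(1) j(1) l(1)] by metis
        qed
      next
        case False
        have "f (a l) = 0" if "l \<in> I - {i}" for l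
        proof (rule antisym)
          show "f (a l) \<le> 0" using F that by (auto simp: not_less)
          show "0 \<le> f (a l)" using False that by (auto simp: not_less)
        qed
        then show ?thesis by (intro none ballI)
      qed
    qed
    then show ?thesis
    proof cases
      case (pos j)
      have bj: "f (a j) \<le> K" using prems(5) pos(1) by (metis abs_le_D1)
      show ?thesis
      proof (cases "a j < a i")
        case True
        define b where "b = a(i := a i - a j)"
        have fb: "(\<lambda>l. f (b l)) = (\<lambda>l. f (a l))(i := K - f (a j))"
          unfolding b_def additive_subtraction[OF prems(1) S i pos(1)] using prems by simp
        have "N b < N a"
          unfolding N_def using card_max_update_less[OF fin _ i, of "K - f (a j)" K "\<lambda>l. f (a l)"] fb
            bj pos K prems by (simp add: fun_eq_iff)
        moreover have "\<forall>l\<in>I. \<bar>f (b l)\<bar> \<le> K" using fb bj pos prems(5) by (auto simp: fun_eq_iff)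
        ultimately show ?thesis unfolding good_def
          using subtractionI[of i I j a] i pos True unfolding b_def by blast
      next
        case False
        then have lt: "a i < a j" using positive_free_less[OF prems(1) i pos(1)] pos(2) by auto
        define b where "b = a(j := a j - a i)"
        have fb: "(\<lambda>l. f (b l)) = (\<lambda>l. f (a l))(j := f (a j) - K)"
          unfolding b_def additive_subtraction[OF prems(1) S pos(1) i] using prems by simp
        show ?thesis
        proof (rule rec[of b])
          show "subtractions I a b" using subtractionI[of j I i a] i pos lt unfolding b_def by blast
          show "b i = r" "f (b i) = K" using prems pos(2) unfolding b_def by auto
          show "\<forall>l\<in>I. \<bar>f (b l)\<bar> \<le> K" using fb bj pos prems(5) K by (auto simp: fun_eq_iff)
          show "N b \<le> N a" unfolding N_def
            using card_max_update_le[OF fin, of "f (a j) - K" K "\<lambda>l. f (a l)" j] fb bj pos K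
            by (simp add: fun_eq_iff)
          have "(\<Sum>j\<in>I. b j) = (\<Sum>j\<in>I. a j) - r"
            unfolding b_def prems(3)[symmetric] by (rule sum_update_minus[OF fin pos(1)])
          then show "(\<Sum>j\<in>I. b j) \<le> (\<Sum>j\<in>I. a j) - r \<or>
            (\<Sum>j\<in>I. b j) \<le> (\<Sum>j\<in>I. a j) \<and> (\<Sum>j\<in>I. nat (- f (b j))) < (\<Sum>j\<in>I. nat (- f (a j)))"
            by simp
        qed
      qed
    next
      case (two j l)
      have ne: "j \<noteq> i" using two prems K by auto
      have bj: "- K \<le> f (a j)" "- K \<le> f (a l)"
        using prems(5) two(1,2) by (metis abs_le_iff minus_le_iff)+
      define b where "b = a(j := a j - a l)"
      have fb: "(\<lambda>l. f (b l)) = (\<lambda>l. f (a l))(j := f (a j) - f (a l))"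
        unfolding b_def additive_subtraction[OF prems(1) S two(1,2)] by simp
      show ?thesis
      proof (rule rec[of b])
        show "subtractions I a b" using subtractionI[of j I l a] two unfolding b_def by blast
        show "b i = r" "f (b i) = K" using prems ne unfolding b_def by auto
        show "\<forall>l\<in>I. \<bar>f (b l)\<bar> \<le> K" using fb bj two prems(5) K by (auto simp: fun_eq_iff)
        show "N b \<le> N a" unfolding N_def
          using card_max_update_le[OF fin, of "f (a j) - f (a l)" K "\<lambda>l. f (a l)" j] fb bj two K
          by (simp add: fun_eq_iff)
        have "(\<Sum>j\<in>I. b j) = (\<Sum>j\<in>I. a j) - a l"
          unfolding b_def by (rule sum_update_minus[OF fin two(1)])
        moreover have "(\<Sum>l\<in>I. nat (- f (b l))) < (\<Sum>j\<in>I. nat (- f (a j)))"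
          using two fb by (intro sum_strict_mono_ex1 fin) (auto simp: fun_eq_iff)
        ultimately show "(\<Sum>j\<in>I. b j) \<le> (\<Sum>j\<in>I. a j) - r \<or>
          (\<Sum>j\<in>I. b j) \<le> (\<Sum>j\<in>I. a j) \<and> (\<Sum>j\<in>I. nat (- f (b j))) < (\<Sum>j\<in>I. nat (- f (a j)))"
          using pos[OF two(2)] by simp
      qed
    next
      case (one j)
      have ji: "j \<noteq> i" using one prems K by auto
      define L where "L = - f (a j)"
      have L: "0 < L" "L \<le> K" using one prems(5) unfolding L_def by (auto simp: abs_le_iff)
      show ?thesis
      proof (cases "L = K")
        case True
        then have fj: "f (a j) = - K" unfolding L_def by simp
        have "\<forall>l\<in>I. K dvd f (a l)"
        proof
          fix l assume "l \<in> I"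
          then consider "l = i" | "l = j" | "f (a l) = 0" using one(3) by blast
          then show "K dvd f (a l)" by cases (simp_all add: prems(4) fj)
        qed
        then have "K = 1" using int_common_divisor[OF fin S _ x0(2) _ K] x0(1) prems(2) by auto
        then have "f (a i) = 1" "f (a j) = - 1" using True L_def prems(4) by auto
        then have "splits I f a" unfolding splits_def using i one ji by (intro bexI[of _ i] bexI[of _ j] conjI) auto
        then show ?thesis unfolding good_def by blast
      next
        case False
        have "I - {i, j} \<noteq> {}"
        proof
          assume "I - {i, j} = {}"
          then have "card I \<le> card {i, j}" by (intro card_mono) auto
          also have "card {i, j} \<le> 2" by (simp add: card_insert_if)
          finally show False using card by simp
        qed
        then obtain l where l: "l \<in> I" "l \<noteq> i" "l \<noteq> j" by blast
        \<comment> \<open>\<open>a j\<close> is first made smaller than \<open>a l\<close>, which costs nothing as \<open>f (a l) = 0\<close>\<close>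
        have fl: "f (a l) = 0" using one l by blast
        obtain a1 where a1: "subtractions I a a1" "a1 j < a l" "a1 j \<le> a j" "\<forall>i. i \<noteq> j \<longrightarrow> a1 i = a i"
          and fa1: "f (a1 j) = f (a j)"
          using reduce_below[OF prems(1) one(1) l(1)] l fl S by metis
        have p1: "positive_free I a1" "int_span I a1 = S"
          using subtractions_preserve[OF a1(1) prems(1)] prems by auto
        have f1: "(\<lambda>m. f (a1 m)) = (\<lambda>m. f (a m))"
          using a1(4) fa1 by (metis (no_types, opaque_lifting))
        define a2 where "a2 = a1(l := a1 l - a1 j)"
        have s2: "subtraction I a1 a2" unfolding a2_def using a1 l one by (intro subtractionI) auto
        have p2: "positive_free I a2" "int_span I a2 = S" using subtraction_preserves[OF p1(1) s2] p1 by auto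
        have f2: "(\<lambda>m. f (a2 m)) = (\<lambda>m. f (a m))(l := L)"
          unfolding a2_def
          by (subst additive_subtraction[OF p1(1) _ l(1) one(1)])
            (use f p1 fl f1 a1(4) l(3) fa1 L_def in \<open>simp_all add: fun_eq_iff\<close>)
        have a12: "subtractions I a a2" using a1(1) s2 by simp
        have a2i: "a2 i = r" "f (a2 i) = K" "f (a2 l) = L"
          using a1(4) ji l prems fun_cong[OF f2, of i] fun_cong[OF f2, of l] unfolding a2_def by simp_all
        have f2a: "additive_on (int_span I a2) f" using f p2 by simp
        have b2: "\<forall>m\<in>I. \<bar>f (a2 m)\<bar> \<le> K" using f2 prems(5) L by (auto simp: fun_eq_iff)
        have N2: "N a2 \<le> N a" unfolding N_def
          using card_max_update_le[OF fin, of L K "\<lambda>l. f (a l)" l] f2 L False by (simp add: fun_eq_iff)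
        show ?thesis
        proof (cases "a2 l < a2 i")
          case True
          define a3 where "a3 = a2(i := a2 i - a2 l)"
          have f3: "(\<lambda>m. f (a3 m)) = (\<lambda>m. f (a2 m))(i := K - L)"
            unfolding a3_def additive_subtraction[OF p2(1) f2a i l(1)] using a2i by simp
          have "N a3 < N a2"
            unfolding N_def using card_max_update_less[OF fin _ i, of "K - L" K "\<lambda>l. f (a2 l)"] f3
              L K a2i by (simp add: fun_eq_iff)
          moreover have "\<forall>l\<in>I. \<bar>f (a3 l)\<bar> \<le> K" using f3 L b2 by (auto simp: fun_eq_iff)
          moreover have "subtractions I a a3"
            using a12 subtractionI[of i I l a2] i l True unfolding a3_def by (meson rtranclp.rtrancl_into_rtrancl)
          ultimately show ?thesis unfolding good_def using N2 by (meson order_less_le_trans)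
        next
          case F: False
          then have lt: "a2 i < a2 l" using positive_free_less[OF p2(1) i l(1)] l by auto
          define a3 where "a3 = a2(l := a2 l - a2 i)"
          have f3: "(\<lambda>m. f (a3 m)) = (\<lambda>m. f (a2 m))(l := L - K)"
            unfolding a3_def additive_subtraction[OF p2(1) f2a l(1) i] using a2i by simp
          show ?thesis
          proof (rule rec[of a3])
            show "subtractions I a a3"
              using a12 subtractionI[of l I i a2] i l lt unfolding a3_def by (meson rtranclp.rtrancl_into_rtrancl)
            show "a3 i = r" "f (a3 i) = K" using a2i l unfolding a3_def by auto
            show "\<forall>l\<in>I. \<bar>f (a3 l)\<bar> \<le> K" using f3 L b2 K by (auto simp: fun_eq_iff)
            have "N a3 \<le> N a2" unfolding N_def
              using card_max_update_le[OF fin, of "L - K" K "\<lambda>l. f (a2 l)" l] f3 L K by (simp add: fun_eq_iff)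
            then show "N a3 \<le> N a" using N2 by simp
            have "(\<Sum>j\<in>I. a3 j) = (\<Sum>j\<in>I. a2 j) - r"
              unfolding a3_def a2i(1)[symmetric] by (rule sum_update_minus[OF fin l(1)])
            moreover have "(\<Sum>j\<in>I. a2 j) \<le> (\<Sum>j\<in>I. a1 j)"
              unfolding a2_def sum_update_minus[OF fin l(1)] using p1(1) one(1)
              unfolding positive_free_def by (simp add: less_imp_le)
            moreover have "(\<Sum>j\<in>I. a1 j) \<le> (\<Sum>j\<in>I. a j)" using a1(3,4) by (intro sum_mono) (metis order_refl)
            ultimately show "(\<Sum>j\<in>I. a3 j) \<le> (\<Sum>j\<in>I. a j) - r \<or>
              (\<Sum>j\<in>I. a3 j) \<le> (\<Sum>j\<in>I. a j) \<and> (\<Sum>j\<in>I. nat (- f (a3 j))) < (\<Sum>j\<in>I. nat (- f (a j)))"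
              by simp
          qed
        qed
      qed
    next
      case none
      have "K dvd f (a l)" if "l \<in> I" for l using none that prems(4) by (cases "l = i") auto
      then have K1: "K = 1" using int_common_divisor[OF fin S _ x0(2) _ K] x0(1) prems(2) by auto
      have "I - {i} \<noteq> {}"
      proof
        assume "I - {i} = {}"
        then have "card I \<le> card {i}" by (intro card_mono) auto
        then show False using card by simp
      qed
      then obtain j where j: "j \<in> I" "j \<noteq> i" by blast
      \<comment> \<open>the vector is the generator \<open>w i\<close>, and \<open>(w i + w j) - w j\<close> after a subdivision that removes \<open>w i\<close>\<close>
      have fj: "f (a j) = 0" using none j by blast
      obtain a1 where a1: "subtractions I a a1" "a1 i < a j" "\<forall>l. l \<noteq> i \<longrightarrow> a1 l = a l"
        and fa1: "f (a1 i) = f (a i)"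
        using reduce_below[OF prems(1) i j(1)] j fj S by metis
      have p1: "positive_free I a1" "int_span I a1 = S"
        using subtractions_preserve[OF a1(1) prems(1)] prems by auto
      define a2 where "a2 = a1(j := a1 j - a1 i)"
      have s2: "subtraction I a1 a2" unfolding a2_def using a1 j i by (intro subtractionI) auto
      have f2: "(\<lambda>m. f (a2 m)) = (\<lambda>m. f (a1 m))(j := - 1)"
        unfolding a2_def
        by (subst additive_subtraction[OF p1(1) _ j(1) i])
          (use f p1 fj a1(3) j fa1 K1 prems(4) in \<open>simp_all add: fun_eq_iff\<close>)
      have "splits I f a2"
        unfolding splits_def
        using i j f2 fa1 prems(4) K1 none a1(3) by (intro bexI[of _ i] bexI[of _ j]) (auto simp: fun_eq_iff)
      moreover have "subtractions I a a2" using a1(1) s2 by simp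
      ultimately show ?thesis unfolding good_def by blast
    qed
  qed
  then show ?case unfolding good_def N_def .
qed

text \<open>
  The descent of \<open>reduce_to_split\<close> treats a maximum attained at a positive value; for a negative one it is
  applied to \<open>- f\<close>, which splits at the same two members in the opposite order.
\<close>
lemma eventually_splits:
  fixes f :: "real \<Rightarrow> int"
  assumes card: "3 \<le> card I" and "additive_on S f" "x0 \<in> S" "f x0 = 1"
    and "positive_free I a" "int_span I a = S"
  shows "\<exists>a'. subtractions I a a' \<and> splits I f a'"
proof -
  have fin: "finite I" using card by (metis card.infinite not_numeral_le_zero)
  have "\<exists>a'. subtractions I a a' \<and> splits I f a'"
    if "positive_free I a" "int_span I a = S" "\<And>i. m i = f (a i)" for m a
    using that
  proof (induction m arbitrary: a rule: wf_induct_rule[OF wf_max_count_less[OF fin]])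
    case (1 m a)
    have m: "m = (\<lambda>i. f (a i))" using "1.prems" by auto
    define K where "K = Max ((\<lambda>j. \<bar>f (a j)\<bar>) ` I)"
    have bound: "\<forall>j\<in>I. \<bar>f (a j)\<bar> \<le> K" unfolding K_def using fin by auto
    have "I \<noteq> {}" using card by auto
    then have "K \<in> (\<lambda>j. \<bar>f (a j)\<bar>) ` I" unfolding K_def using fin by (intro Max_in) auto
    then obtain i where i: "i \<in> I" "\<bar>f (a i)\<bar> = K" by auto
    have S: "additive_on (int_span I a) f" using assms(2) "1.prems" by simp
    have K: "0 < K"
    proof (rule ccontr)
      assume "\<not> 0 < K"
      then have "f (a j) = 0" if "j \<in> I" for j using bound that by fastforce
      then have "\<forall>j\<in>I. 2 dvd f (a j)" by simp
      then show False using int_common_divisor[OF fin S _ assms(4), of 2] assms(3) "1.prems"(2) by simp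
    qed
    have "\<exists>a'. subtractions I a a' \<and> (splits I f a' \<or>
      (\<forall>j\<in>I. \<bar>f (a' j)\<bar> \<le> K) \<and> card {j\<in>I. \<bar>f (a' j)\<bar> = K} < card {j\<in>I. \<bar>f (a j)\<bar> = K})"
    proof (cases "f (a i) = K")
      case True
      show ?thesis
        using reduce_to_split[OF card assms(2-4) i(1) K "1.prems"(1,2) refl True bound] by blast
    next
      case False
      let ?g = "\<lambda>x. - f x"
      have x: "- x0 \<in> S" "?g (- x0) = 1"
      proof -
        have "0 \<in> S" using int_span_0[of I a] "1.prems" by simp
        then show "- x0 \<in> S" using int_span_diff[of 0 I a x0] assms(3) "1.prems"(2) by simp
        have d: "f (x - y) = f x - f y" if "x \<in> S" "y \<in> S" for x y
          using assms(2) that unfolding additive_on_def by blast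
        show "?g (- x0) = 1" using d[OF \<open>0 \<in> S\<close> \<open>0 \<in> S\<close>] d[OF \<open>0 \<in> S\<close> assms(3)] assms(4) by simp
      qed
      have g: "additive_on S ?g" using assms(2) unfolding additive_on_def by simp
      have "?g (a i) = K" using False i by linarith
      then obtain a' where a': "subtractions I a a'" "splits I ?g a' \<or>
         (\<forall>j\<in>I. \<bar>f (a' j)\<bar> \<le> K) \<and> card {j\<in>I. \<bar>f (a' j)\<bar> = K} < card {j\<in>I. \<bar>f (a j)\<bar> = K}"
        using reduce_to_split[OF card g x i(1) K "1.prems"(1,2) refl] bound by auto
      have "splits I f a'" if g_splits: "splits I ?g a'"
      proof -
        obtain h k where "h \<in> I" "k \<in> I" "h \<noteq> k" "- f (a' h) = 1" "- f (a' k) = - 1"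
          "\<forall>i\<in>I - {h, k}. - f (a' i) = 0"
          using g_splits unfolding splits_def by blast
        then show ?thesis unfolding splits_def by (intro bexI[of _ k] bexI[of _ h]) auto
      qed
      then show ?thesis using a' by blast
    qed
    then obtain a' where a': "subtractions I a a'" "splits I f a' \<or>
      (\<forall>j\<in>I. \<bar>f (a' j)\<bar> \<le> K) \<and> card {j\<in>I. \<bar>f (a' j)\<bar> = K} < card {j\<in>I. \<bar>f (a j)\<bar> = K}" by blast
    show ?case
    proof (cases "splits I f a'")
      case True then show ?thesis using a' by blast
    next
      case False
      then have "((\<lambda>j. f (a' j)), m) \<in> max_count_less I"
        using a'(2) bound unfolding m by (intro max_count_lessI[of _ _ K]) auto
      moreover have "positive_free I a'" "int_span I a' = S"
        using subtractions_preserve[OF a'(1)] "1.prems" by auto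
      ultimately obtain a'' where "subtractions I a' a''" "splits I f a''" using "1.IH" by blast
      then show ?thesis using a'(1) by (meson rtranclp_trans)
    qed
  qed
  from this[of a "\<lambda>i. f (a i)"] show ?thesis using assms by blast
qed

section \<open>Lifting subtractions from the kernel of a functional\<close>

text \<open>
  The family \<open>y\<close> with \<open>y k\<close> broken into the two parts \<open>q\<close> and \<open>y k - q\<close>.  If \<open>w\<close> is the difference of the
  generators \<open>h\<close> and \<open>k\<close>, then \<open>y\<close> gives the coordinates of \<open>v\<close> modulo \<open>w\<close>: the two generators have the same
  image, and their coordinates add up.
\<close>
definition split_at :: "'i \<Rightarrow> 'i \<Rightarrow> real \<Rightarrow> ('i \<Rightarrow> real) \<Rightarrow> 'i \<Rightarrow> real" where
  "split_at h k q y = y(k := y k - q, h := q)"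

text \<open>
  The only steps that need an idea involve the member \<open>y k\<close> that is broken up.  Subtracting the parts of \<open>y k\<close> one after the other amounts to subtracting
  \<open>y k\<close>.  Conversely \<open>y j\<close> is subtracted from \<open>y k\<close> by taking it from a part that exceeds it; if \<open>y j\<close> exceeds
  both parts, then \<open>y j\<close> takes over the role of the broken member, with parts \<open>q\<close> and \<open>y j - q\<close>.
\<close>
lemma lift_subtraction:
  assumes h: "h \<notin> I" and k: "k \<in> I" and q: "0 < q" "q < y k"
    and free: "positive_free (insert h I) (split_at h k q y)" and s: "subtraction I y y'"
  shows "\<exists>k' q'. k' \<in> I \<and> 0 < q' \<and> q' < y' k' \<and> q - q' \<in> int_span I y \<and>
     subtractions (insert h I) (split_at h k q y) (split_at h k' q' y')"
proof -
  let ?J = "insert h I"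
  let ?a = "split_at h k q y"
  obtain i j where ij: "i \<in> I" "j \<in> I" "y j < y i" and y': "y' = y(i := y i - y j)"
    using s unfolding subtraction_def by blast
  have fin: "finite I" using free unfolding positive_free_def by auto
  have ne: "i \<noteq> j" "i \<noteq> h" "j \<noteq> h" "k \<noteq> h" using ij h k by auto
  have a: "?a h = q" "?a k = y k - q" "\<And>l. l \<noteq> h \<Longrightarrow> l \<noteq> k \<Longrightarrow> ?a l = y l"
    using ne unfolding split_at_def by auto
  have zero: "0 \<in> int_span I y" and yj: "y j \<in> int_span I y"
    using int_span_0 int_span_base[OF fin ij(2)] by auto
  consider (away) "i \<noteq> k" "j \<noteq> k" | (sub) "j = k" | (bigp) "i = k" "y j < y k - q"
    | (bigq) "i = k" "y j < q" | (small) "i = k" "\<not> y j < y k - q" "\<not> y j < q" by blast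
  then show ?thesis
  proof cases
    case away
    have "split_at h k q y' = ?a(i := ?a i - ?a j)"
      using away ne unfolding y' split_at_def by (auto simp: fun_eq_iff)
    moreover have "?a j < ?a i" using away ne ij a by simp
    ultimately have "subtractions ?J ?a (split_at h k q y')"
      using subtractionI[of i ?J j ?a] ij by auto
    moreover have "q < y' k" using away q unfolding y' by simp
    ultimately show ?thesis using k q zero by (intro exI[of _ k] exI[of _ q]) auto
  next
    case sub
    then have ik: "i \<noteq> k" using ne by auto
    define b where "b = ?a(i := ?a i - ?a h)"
    have "?a h < ?a i" using ik a ne q ij sub by simp
    then have s1: "subtraction ?J ?a b" unfolding b_def using ij by (intro subtractionI) auto
    have "b k < b i" using ik a ne q ij sub unfolding b_def by simp
    then have s2: "subtraction ?J b (b(i := b i - b k))" using ij k by (intro subtractionI) auto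
    have "split_at h k q y' = b(i := b i - b k)"
      using ik ne sub unfolding y' b_def split_at_def by (auto simp: fun_eq_iff)
    then have "subtractions ?J ?a (split_at h k q y')" using s1 s2 by auto
    moreover have "q < y' k" using ik q unfolding y' by simp
    ultimately show ?thesis using k q zero by (intro exI[of _ k] exI[of _ q]) auto
  next
    case bigp
    have "split_at h k q y' = ?a(k := ?a k - ?a j)"
      using bigp ne unfolding y' split_at_def by (auto simp: fun_eq_iff)
    moreover have "?a j < ?a k" using bigp ne ij a by simp
    ultimately have "subtractions ?J ?a (split_at h k q y')"
      using subtractionI[of k ?J j ?a] ij k by auto
    moreover have "q < y' k" using bigp q unfolding y' by simp
    ultimately show ?thesis using k q zero by (intro exI[of _ k] exI[of _ q]) auto
  next
    case bigq
    have "split_at h k (q - y j) y' = ?a(h := ?a h - ?a j)"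
      using bigq ne unfolding y' split_at_def by (auto simp: fun_eq_iff)
    moreover have "?a j < ?a h" using bigq ne ij a by simp
    ultimately have "subtractions ?J ?a (split_at h k (q - y j) y')"
      using subtractionI[of h ?J j ?a] ij k by auto
    moreover have "q - y j < y' k" "0 < q - y j" using bigq q unfolding y' by auto
    ultimately show ?thesis using k q yj by (intro exI[of _ k] exI[of _ "q - y j"]) auto
  next
    case small
    have lt1: "?a h < ?a j"
      using positive_free_less[OF free, of h j] small ne ij a by auto
    have "?a k < ?a j" using positive_free_less[OF free, of k j] small ne ij a k by auto
    define b where "b = ?a(j := ?a j - ?a h)"
    have s1: "subtraction ?J ?a b" unfolding b_def using ij lt1 by (intro subtractionI) auto
    have "b j < b k" using small a ne ij unfolding b_def by auto
    then have s2: "subtraction ?J b (b(k := b k - b j))" using ij k by (intro subtractionI) auto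
    have "split_at h j q y' = b(k := b k - b j)"
      using ne small unfolding y' b_def split_at_def by (auto simp: fun_eq_iff)
    then have "subtractions ?J ?a (split_at h j q y')" using s1 s2 by auto
    moreover have "q < y' j" using small ne a lt1 unfolding y' by simp
    ultimately show ?thesis using ij q zero by (intro exI[of _ j] exI[of _ q]) auto
  qed
qed

lemma lift_subtractions:
  assumes "subtractions I y y'" and h: "h \<notin> I" and k: "k \<in> I" and q: "0 < q" "q < y k"
    and free: "positive_free (insert h I) (split_at h k q y)" and fy: "positive_free I y"
  shows "\<exists>k' q'. k' \<in> I \<and> 0 < q' \<and> q' < y' k' \<and> q - q' \<in> int_span I y \<and>
     subtractions (insert h I) (split_at h k q y) (split_at h k' q' y')"
  using assms(1)
proof (induction rule: rtranclp_induct)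
  case base
  then show ?case using k q int_span_0 by (intro exI[of _ k] exI[of _ q]) auto
next
  case (step y1 y2)
  then obtain k1 q1 where 1: "k1 \<in> I" "0 < q1" "q1 < y1 k1" "q - q1 \<in> int_span I y"
    "subtractions (insert h I) (split_at h k q y) (split_at h k1 q1 y1)" by blast
  have "positive_free (insert h I) (split_at h k1 q1 y1)" using subtractions_preserve[OF 1(5) free] by blast
  from lift_subtraction[OF h 1(1-3) this step(2)] obtain k2 q2 where
    2: "k2 \<in> I" "0 < q2" "q2 < y2 k2" "q1 - q2 \<in> int_span I y1"
    "subtractions (insert h I) (split_at h k1 q1 y1) (split_at h k2 q2 y2)" by blast
  have "int_span I y1 = int_span I y" using subtractions_preserve[OF step(1) fy] by blast
  then have "q - q2 \<in> int_span I y" using int_span_add[OF 1(4), of "q1 - q2"] 2(4) by simp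
  then show ?case using 1(5) 2 by (meson rtranclp_trans)
qed

section \<open>Functionals, their kernels, and split families\<close>

lemma ex_coordinate:
  assumes "positive_free J b" "h \<in> J"
  shows "\<exists>f. additive_on (int_span J b) f \<and> (\<forall>c. f (\<Sum>j\<in>J. of_int (c j) * b j) = c h)"
proof -
  define f where "f x = (SOME c. x = (\<Sum>j\<in>J. of_int (c j) * b j)) h" for x
  have f: "f (\<Sum>j\<in>J. of_int (c j) * b j) = c h" for c
  proof -
    let ?P = "\<lambda>d. (\<Sum>j\<in>J. of_int (c j) * b j) = (\<Sum>j\<in>J. of_int (d j) * b j)"
    have "?P (SOME d. ?P d)" by (rule someI[of ?P c]) simp
    from positive_free_coeff_unique[OF assms(1) this assms(2)] show ?thesis unfolding f_def by simp
  qed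
  have "f (x - y) = f x - f y" if "x \<in> int_span J b" "y \<in> int_span J b" for x y
  proof -
    obtain c d where c: "x = (\<Sum>j\<in>J. of_int (c j) * b j)" "y = (\<Sum>j\<in>J. of_int (d j) * b j)"
      using \<open>x \<in> _\<close> \<open>y \<in> _\<close> unfolding int_span_def by blast
    then have "x - y = (\<Sum>j\<in>J. of_int (c j - d j) * b j)"
      by (simp add: sum_subtractf algebra_simps)
    then show ?thesis using f[of "\<lambda>j. c j - d j"] f[of c] f[of d] c by simp
  qed
  then show ?thesis using f unfolding additive_on_def by blast
qed

lemma additive_on_base:
  assumes "finite J" and f: "\<forall>c. f (\<Sum>j\<in>J. of_int (c j) * b j) = c h" and "j \<in> J"
  shows "f (b j) = (if j = h then 1 else 0 :: int)"
proof -
  let ?c = "\<lambda>l. if l = j then 1 else 0 :: int"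
  have "(\<Sum>l\<in>J. of_int (?c l) * b l) = (\<Sum>l\<in>J. if l = j then b l else 0)"
    by (rule sum.cong) auto
  then have "(\<Sum>l\<in>J. of_int (?c l) * b l) = b j" using assms by simp
  then show ?thesis using spec[OF f, of ?c] by simp
qed

lemma positive_free_subset:
  assumes "positive_free J b" "J' \<subseteq> J"
  shows "positive_free J' b"
  unfolding positive_free_def
proof (intro conjI allI impI)
  have fin: "finite J" and pos: "\<forall>j\<in>J. 0 < b j"
    and ind: "\<And>c :: 'a \<Rightarrow> int. (\<Sum>j\<in>J. of_int (c j) * b j) = 0 \<Longrightarrow> \<forall>j\<in>J. c j = 0"
    using assms(1) unfolding positive_free_def by auto
  show "finite J'" using finite_subset[OF assms(2) fin] .
  show "\<forall>j\<in>J'. 0 < b j" using pos assms(2) by auto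
  fix c :: "'a \<Rightarrow> int" assume c: "(\<Sum>j\<in>J'. of_int (c j) * b j) = 0"
  let ?d = "\<lambda>j. if j \<in> J' then c j else 0"
  have "(\<Sum>j\<in>J. of_int (?d j) * b j) = (\<Sum>j\<in>J'. of_int (c j) * b j)"
    using assms(2) fin by (intro sum.mono_neutral_cong_right) auto
  then show "\<forall>j\<in>J'. c j = 0" using ind[of ?d] c assms(2) by (metis subsetD)
qed

lemma kernel_coordinate:
  assumes "finite J" "h \<in> J" and f: "\<forall>c. f (\<Sum>j\<in>J. of_int (c j) * b j) = (c h :: int)"
  shows "{x \<in> int_span J b. f x = 0} = int_span (J - {h}) b"
proof -
  have eq: "(\<Sum>j\<in>J. of_int (c j) * b j) = of_int (c h) * b h + (\<Sum>j\<in>J-{h}. of_int (c j) * b j)"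
    for c :: "'a \<Rightarrow> int"
    using assms by (simp add: sum.remove)
  show ?thesis
  proof (intro set_eqI iffI)
    fix x assume "x \<in> {x \<in> int_span J b. f x = 0}"
    then obtain c where c: "x = (\<Sum>j\<in>J. of_int (c j) * b j)" "f x = 0"
      unfolding int_span_def by blast
    then have "c h = 0" using f by simp
    then have "x = (\<Sum>j\<in>J-{h}. of_int (c j) * b j)" using eq c by simp
    then show "x \<in> int_span (J - {h}) b" using int_spanI by blast
  next
    fix x assume "x \<in> int_span (J - {h}) b"
    then obtain c where c: "x = (\<Sum>j\<in>J-{h}. of_int (c j) * b j)" unfolding int_span_def by blast
    let ?c = "c(h := 0)"
    have "(\<Sum>j\<in>J-{h}. of_int (?c j) * b j) = (\<Sum>j\<in>J-{h}. of_int (c j) * b j)"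
      by (rule sum.cong) auto
    then have x: "x = (\<Sum>j\<in>J. of_int (?c j) * b j)" using eq[of ?c] c by simp
    then have "x \<in> int_span J b" using int_spanI by blast
    moreover have "f x = 0" using spec[OF f, of ?c] x by simp
    ultimately show "x \<in> {x \<in> int_span J b. f x = 0}" by simp
  qed
qed

lemma split_sum:
  assumes "finite I" "h \<notin> I" "k \<in> I"
  shows "(\<Sum>i\<in>insert h I. g i * split_at h k q y i) = (\<Sum>i\<in>I. g i * y i) + (g h - g k) * q"
proof -
  have "(\<Sum>i\<in>I. g i * split_at h k q y i) = (\<Sum>i\<in>I. g i * (y(k := y k - q)) i)"
    using assms by (intro sum.cong) (auto simp: split_at_def)
  also have "\<dots> = (\<Sum>i\<in>I. g i * y i) - g k * q"
    using sum_update[OF assms(1,3), of "\<lambda>i x. g i * x" y "y k - q"] by (simp add: algebra_simps)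
  finally show ?thesis using assms by (simp add: split_at_def algebra_simps)
qed

lemma split_functional:
  assumes "finite I" "h \<notin> I" "k \<in> I"
    and f: "additive_on (int_span (insert h I) (split_at h k q y)) f"
    and fq: "f q = 1" "f (y k - q) = - 1" "\<forall>i\<in>I - {k}. f (y i) = 0"
  shows "f (\<Sum>i\<in>insert h I. of_int (c i) * split_at h k q y i) = c h - c k"
proof -
  have kh: "k \<noteq> h" using assms(2,3) by auto
  have "(\<Sum>i\<in>I. c i * f (split_at h k q y i)) = (\<Sum>i\<in>I. if i = k then - c k else 0)"
    using fq assms(2) kh by (intro sum.cong) (auto simp: split_at_def)
  also have "\<dots> = - c k" using assms(1,3) by simp
  finally show ?thesis
    using additive_on_sum[OF f, of c] assms(1,2) fq(1) by (simp add: split_at_def)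
qed

text \<open>
  The functional takes the value \<open>c h - c k\<close> at the combination with coefficients \<open>c\<close>, so on its kernel the
  parts \<open>q\<close> and \<open>y k - q\<close> occur equally often and can be put together.
\<close>
lemma kernel_split:
  assumes free: "positive_free (insert h I) (split_at h k q y)" and "h \<notin> I" "k \<in> I"
    and f: "additive_on (int_span (insert h I) (split_at h k q y)) f"
    and fq: "f q = 1" "f (y k - q) = - 1" "\<forall>i\<in>I - {k}. f (y i) = 0"
  shows "positive_free I y" "int_span I y = {x \<in> int_span (insert h I) (split_at h k q y). f x = 0}"
proof -
  let ?a = "split_at h k q y"
  have fin: "finite I" and pos: "\<forall>i\<in>insert h I. 0 < ?a i"
    and ind: "\<And>c :: 'a \<Rightarrow> int. (\<Sum>i\<in>insert h I. of_int (c i) * ?a i) = 0 \<Longrightarrow> \<forall>i\<in>insert h I. c i = 0"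
    using free unfolding positive_free_def by auto
  have kh: "k \<noteq> h" using assms by auto
  have sum_eq: "(\<Sum>i\<in>I. of_int (c i) * y i) = (\<Sum>i\<in>insert h I. of_int ((c(h := c k)) i) * ?a i)"
    for c :: "'a \<Rightarrow> int"
  proof -
    have "(\<Sum>i\<in>I. of_int ((c(h := c k)) i) * y i) = (\<Sum>i\<in>I. of_int (c i) * y i)"
      using assms(2) by (intro sum.cong) auto
    then show ?thesis
      using split_sum[OF fin assms(2,3), of "\<lambda>i. of_int ((c(h := c k)) i)" q y] kh by simp
  qed
  have f_sum: "f (\<Sum>i\<in>insert h I. of_int (c i) * ?a i) = c h - c k" for c :: "'a \<Rightarrow> int"
    by (rule split_functional[OF fin assms(2,3) f fq])
  show "positive_free I y"
    unfolding positive_free_def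
  proof (intro conjI allI impI fin)
    show "\<forall>i\<in>I. 0 < y i"
    proof
      fix i assume i: "i \<in> I"
      have "0 < ?a h" "0 < ?a i" using pos i by auto
      then show "0 < y i" using assms(2) i kh by (auto simp: split_at_def split: if_splits)
    qed
    fix c :: "'a \<Rightarrow> int" assume "(\<Sum>i\<in>I. of_int (c i) * y i) = 0"
    then have "\<forall>i\<in>insert h I. (c(h := c k)) i = 0" unfolding sum_eq by (rule ind)
    then show "\<forall>i\<in>I. c i = 0" using assms(2) by (metis fun_upd_other insertI2)
  qed
  show "int_span I y = {x \<in> int_span (insert h I) ?a. f x = 0}"
  proof (intro set_eqI iffI)
    fix x assume "x \<in> int_span I y"
    then obtain c where c: "x = (\<Sum>i\<in>I. of_int (c i) * y i)" unfolding int_span_def by blast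
    show "x \<in> {x \<in> int_span (insert h I) ?a. f x = 0}"
      using f_sum[of "c(h := c k)"] kh int_spanI[of "c(h := c k)" ?a "insert h I"] unfolding c sum_eq by simp
  next
    fix x assume "x \<in> {x \<in> int_span (insert h I) ?a. f x = 0}"
    then obtain c where c: "x = (\<Sum>i\<in>insert h I. of_int (c i) * ?a i)" "f x = 0"
      unfolding int_span_def by blast
    then have "c h = c k" using f_sum by simp
    then have "c(h := c k) = c" by auto
    then have "x = (\<Sum>i\<in>I. of_int (c i) * y i)" unfolding sum_eq using c(1) by simp
    then show "x \<in> int_span I y" using int_spanI by blast
  qed
qed

text \<open>
  Let \<open>x = \<alpha> q + \<beta> (y k - q) + \<dots>\<close> with coefficients in \<open>\<nat>\<close>.  Then \<open>f x = 1\<close> reads \<open>\<alpha> = \<beta> + 1\<close>, so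
  \<open>x - q = \<beta> y k + \<dots>\<close> is again a combination with coefficients in \<open>\<nat>\<close>.
\<close>
lemma nat_span_split:
  assumes "positive_free (insert h I) (split_at h k q y)" and "h \<notin> I" "k \<in> I"
    and f: "additive_on (int_span (insert h I) (split_at h k q y)) f"
    and fq: "f q = 1" "f (y k - q) = - 1" "\<forall>i\<in>I - {k}. f (y i) = 0"
    and x: "x \<in> nat_span (insert h I) (split_at h k q y)" "f x = 1"
  shows "x - q \<in> nat_span I y"
proof -
  let ?a = "split_at h k q y"
  have fin: "finite I" using assms(1) unfolding positive_free_def by auto
  obtain c :: "'a \<Rightarrow> nat" where c: "x = (\<Sum>i\<in>insert h I. of_nat (c i) * ?a i)"
    using x(1) unfolding nat_span_def by blast
  then have "x = (\<Sum>i\<in>insert h I. of_int (int (c i)) * ?a i)" by simp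
  then have "f x = int (c h) - int (c k)"
    using split_functional[OF fin assms(2,3) f fq, of "\<lambda>i. int (c i)"] by simp
  then have "real (c h) - real (c k) = 1" using x(2) by linarith
  then have "x - q = (\<Sum>i\<in>I. of_nat (c i) * y i)"
    unfolding c split_sum[OF fin assms(2,3), of "\<lambda>i. of_nat (c i)" q y] by simp
  then show ?thesis using nat_spanI[of c y I] by simp
qed

lemma nat_span_cong_image:
  assumes "inj_on y I" "inj_on b J" "y ` I = b ` J"
  shows "nat_span I y \<subseteq> nat_span J b"
proof
  fix x assume "x \<in> nat_span I y"
  then obtain c :: "'a \<Rightarrow> nat" where c: "x = (\<Sum>i\<in>I. of_nat (c i) * y i)"
    unfolding nat_span_def by blast
  have "x = (\<Sum>i\<in>I. of_nat (c (inv_into I y (y i))) * y i)"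
    unfolding c using assms(1) by (intro sum.cong) auto
  also have "\<dots> = (\<Sum>z\<in>y ` I. of_nat (c (inv_into I y z)) * z)"
    using assms(1) by (simp add: sum.reindex)
  also have "\<dots> = (\<Sum>j\<in>J. of_nat (c (inv_into I y (b j))) * b j)"
    unfolding assms(3) using assms(2) by (simp add: sum.reindex)
  finally show "x \<in> nat_span J b" using nat_spanI[of "\<lambda>j. c (inv_into I y (b j))" b J] by simp
qed

lemma subtract_nat_span:
  assumes "finite J" "\<forall>j\<in>J. 0 < b j" "h \<notin> J" "0 < q" "e \<in> nat_span J b"
  shows "subtractions (insert h J) (b(h := q + e)) (b(h := q))"
proof -
  obtain c :: "'a \<Rightarrow> nat" where "e = (\<Sum>j\<in>J. of_nat (c j) * b j)"
    using assms(5) unfolding nat_span_def by blast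
  then show ?thesis
  proof (induction "\<Sum>j\<in>J. c j" arbitrary: c e rule: less_induct)
    case less
    show ?case
    proof (cases "\<forall>j\<in>J. c j = 0")
      case True
      then have "e = 0" using less by simp
      then show ?thesis by simp
    next
      case False
      then obtain j where j: "j \<in> J" "0 < c j" by auto
      have cj: "c j = Suc (c j - 1)" using j by simp
      let ?d = "c(j := c j - 1)"
      have e: "e - b j = (\<Sum>l\<in>J. of_nat (?d l) * b l)"
        using sum_update[OF assms(1) j(1), of "\<lambda>l x. of_nat x * b l" c "c j - 1"] j(2) less.prems
        by (simp add: algebra_simps of_nat_diff)
      have "(\<Sum>l\<in>J. ?d l) < (\<Sum>l\<in>J. c l)"
        using j by (intro sum_strict_mono_ex1 assms) auto
      then have rec: "subtractions (insert h J) (b(h := q + (e - b j))) (b(h := q))"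
        using less.hyps[of ?d] e by simp
      have "0 \<le> e - b j" unfolding e using assms(2) by (intro sum_nonneg) (auto simp: less_imp_le)
      then have "b j < q + e" using assms(4) by simp
      moreover have hj: "h \<noteq> j" using assms j by auto
      ultimately have "subtraction (insert h J) (b(h := q + e)) (b(h := q + e - b j))"
        using subtractionI[of h "insert h J" j "b(h := q + e)"] j by simp
      then show ?thesis using rec by (simp add: algebra_simps converse_rtranclp_into_rtranclp)
    qed
  qed
qed

section \<open>Rank two\<close>

lemma int_span_two:
  assumes "j1 \<noteq> j2" "x \<in> int_span {j1, j2} b"
  shows "\<exists>u v. x = of_int u * b j1 + of_int v * b j2"
  using assms unfolding int_span_def by auto

lemma positive_free_two:
  assumes "positive_free {j1, j2} b" "j1 \<noteq> j2"
    "of_int u * b j1 + of_int v * b j2 = of_int u' * b j1 + of_int v' * b j2"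
  shows "u = u' \<and> v = v'"
proof -
  let ?c = "\<lambda>j. if j = j1 then u else v" and ?d = "\<lambda>j. if j = j1 then u' else v'"
  have "(\<Sum>j\<in>{j1, j2}. of_int (?c j) * b j) = (\<Sum>j\<in>{j1, j2}. of_int (?d j) * b j)"
    using assms(2,3) by simp
  note * = positive_free_coeff_unique[OF assms(1) this]
  show ?thesis using *[of j1] *[of j2] assms(2) by simp
qed

text \<open>
  The determinant of the matrix is \<open>\<plusminus>1\<close>, but it is at least \<open>(y1 + 1) (x2 + 1) - x2 y1 = x2 + y1 + 1\<close> by the
  last two assumptions.
\<close>
lemma unimodular_nat_matrix:
  fixes x1 x2 y1 y2 :: nat and u v u' v' :: int
  assumes "u * x1 + v * y1 = 1" "u * x2 + v * y2 = 0" "u' * x1 + v' * y1 = 0" "u' * x2 + v' * y2 = 1"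
    and "y1 < x1" "x2 < y2"
  shows "x1 = 1 \<and> y2 = 1 \<and> x2 = 0 \<and> y1 = 0"
proof -
  have "(u * v' - v * u') * (int x1 * int y2 - int x2 * int y1)
      = (u * x1 + v * y1) * (u' * x2 + v' * y2) - (u * x2 + v * y2) * (u' * x1 + v' * y1)"
    by (simp add: algebra_simps)
  also have "\<dots> = 1" using assms by simp
  finally have "(int x1 * int y2 - int x2 * int y1) dvd 1" by (metis dvd_triv_right)
  then have D: "\<bar>int x1 * int y2 - int x2 * int y1\<bar> = 1" by simp
  have "(y1 + 1) * (x2 + 1) \<le> x1 * y2" using assms(5,6) by (intro mult_mono) auto
  then have "int ((y1 + 1) * (x2 + 1)) \<le> int (x1 * y2)" by (rule of_nat_mono)
  then have "int x2 * int y1 + int x2 + int y1 + 1 \<le> int x1 * int y2" by (simp add: algebra_simps)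
  then have 0: "x2 = 0" "y1 = 0" using D by linarith+
  then have "int x1 * int y2 = 1" using D by (simp add: abs_mult)
  then have "x1 * y2 = 1" by (metis of_nat_1_eq_iff of_nat_mult)
  then show ?thesis using 0 by simp
qed

text \<open>
  The Euclidean algorithm for unimodular matrices over \<open>\<nat>\<close>.  If the row of the larger of \<open>a i1\<close> and \<open>a i2\<close>
  dominates the other row, a subtraction keeps the entries in \<open>\<nat>\<close> and lowers their sum.  The row of
  the smaller one cannot dominate, and if neither does, the determinant leaves only permutation matrices.
\<close>
lemma common_subtraction_two:
  assumes "positive_free {j1, j2} b" "j1 \<noteq> j2" "i1 \<noteq> i2"
    "positive_free {i1, i2} a" "int_span {i1, i2} a = int_span {j1, j2} b"
    "a i1 = of_nat x1 * b j1 + of_nat x2 * b j2" "a i2 = of_nat y1 * b j1 + of_nat y2 * b j2"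
  shows "\<exists>a'. subtractions {i1, i2} a a' \<and> a' ` {i1, i2} = b ` {j1, j2}"
  using assms(3-)
proof (induction "x1 + x2 + y1 + y2" arbitrary: a i1 i2 x1 x2 y1 y2 rule: less_induct)
  case less
  have step: "\<exists>a'. subtractions {i1, i2} a a' \<and> a' ` {i1, i2} = b ` {j1, j2}"
    if N: "x1' + x2' + y1' + y2' = x1 + x2 + y1 + y2" and ne: "k1 \<noteq> k2"
      and k: "{k1, k2} = {i1, i2}"
      and a: "a k1 = of_nat x1' * b j1 + of_nat x2' * b j2" "a k2 = of_nat y1' * b j1 + of_nat y2' * b j2"
      and lt: "a k2 < a k1" for k1 k2 :: 'b and x1' x2' y1' y2' :: nat
  proof -
    have free: "positive_free {k1, k2} a" and span: "int_span {k1, k2} a = int_span {j1, j2} b"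
      using less.prems k by auto
    have posb: "0 < b j1" "0 < b j2" using assms(1) unfolding positive_free_def by auto
    have posa: "0 < a k2" using free unfolding positive_free_def by auto
    show ?thesis
    proof (cases "y1' \<le> x1' \<and> y2' \<le> x2'")
      case True
      define a' where "a' = a(k1 := a k1 - a k2)"
      have s: "subtraction {k1, k2} a a'" unfolding a'_def using lt by (intro subtractionI) auto
      have p: "positive_free {k1, k2} a'" "int_span {k1, k2} a' = int_span {j1, j2} b"
        using subtraction_preserves[OF free s] span by auto
      have "a' k1 = of_nat (x1' - y1') * b j1 + of_nat (x2' - y2') * b j2"
        "a' k2 = of_nat y1' * b j1 + of_nat y2' * b j2"
        using True a ne unfolding a'_def by (simp_all add: of_nat_diff algebra_simps)
      moreover have "0 < y1' + y2'" using posa a(2) by (cases "y1' = 0 \<and> y2' = 0") auto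
      then have "(x1' - y1') + (x2' - y2') + y1' + y2' < x1 + x2 + y1 + y2"
        using True N by linarith
      ultimately obtain a'' where "subtractions {k1, k2} a' a''" "a'' ` {k1, k2} = b ` {j1, j2}"
        using less.hyps ne p by blast
      then show ?thesis using s unfolding k by (meson converse_rtranclp_into_rtranclp)
    next
      case False
      have nle: "\<not> (x1' \<le> y1' \<and> x2' \<le> y2')"
      proof
        assume "x1' \<le> y1' \<and> x2' \<le> y2'"
        then have "a k1 \<le> a k2" unfolding a using posb by (intro add_mono mult_right_mono) auto
        then show False using lt by simp
      qed
      have "b j1 \<in> int_span {k1, k2} a" "b j2 \<in> int_span {k1, k2} a"
        unfolding span by (intro int_span_base; simp)+
      then obtain u v u' v' where 1: "b j1 = of_int u * a k1 + of_int v * a k2"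
        and 2: "b j2 = of_int u' * a k1 + of_int v' * a k2"
        using int_span_two[OF ne] by blast
      have "of_int 1 * b j1 + of_int 0 * b j2
        = of_int (u * x1' + v * y1') * b j1 + of_int (u * x2' + v * y2') * b j2"
        using 1 unfolding a by (simp add: algebra_simps)
      from positive_free_two[OF assms(1,2) this]
      have e1: "u * x1' + v * y1' = 1" "u * x2' + v * y2' = 0" by auto
      have "of_int 0 * b j1 + of_int 1 * b j2
        = of_int (u' * x1' + v' * y1') * b j1 + of_int (u' * x2' + v' * y2') * b j2"
        using 2 unfolding a by (simp add: algebra_simps)
      from positive_free_two[OF assms(1,2) this]
      have e2: "u' * x1' + v' * y1' = 0" "u' * x2' + v' * y2' = 1" by auto
      consider "y1' < x1'" "x2' < y2'" | "x1' < y1'" "y2' < x2'" using False nle by linarith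
      then have "a ` {k1, k2} = b ` {j1, j2}"
      proof cases
        case 1
        then show ?thesis using unimodular_nat_matrix[OF e1 e2] a by simp
      next
        case 2
        have "x2' = 1 \<and> y1' = 1 \<and> x1' = 0 \<and> y2' = 0"
          using unimodular_nat_matrix[of u' x2' v' y2' x1' y1' u v] e1 e2 2 by simp
        then show ?thesis using a by auto
      qed
      then show ?thesis unfolding k by blast
    qed
  qed
  show ?case
  proof (cases "a i2 < a i1")
    case True
    show ?thesis by (rule step[OF refl less.prems(1) refl less.prems(4,5) True])
  next
    case False
    then have "a i1 < a i2" using positive_free_less[OF less.prems(2)] less.prems(1) by auto
    then show ?thesis
      using step[of y1 y2 x1 x2 i2 i1] less.prems(1,4,5) by (auto simp: insert_commute)
  qed
qed

section \<open>A common family\<close>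

text \<open>
  In rank at least three, \<open>f\<close> is the generator dual to \<open>s = b j0\<close>, which is turned into a difference of two
  generators of the other cone.  The induction hypothesis is applied to the kernel of \<open>f\<close>.
\<close>
theorem common_subtraction:
  fixes a :: "'i \<Rightarrow> real" and b :: "'j \<Rightarrow> real"
  assumes "positive_free I a" "positive_free J b" "card I = card J" "int_span I a = int_span J b"
  shows "\<exists>a' b'. subtractions I a a' \<and> subtractions J b b' \<and> a' ` I = b' ` J"
  using assms
proof (induction "card I" arbitrary: I J a b)
  case 0
  then have "I = {}" "J = {}" unfolding positive_free_def by auto
  then show ?case by blast
next
  case (Suc n)
  have fin: "finite I" "finite J" using Suc.prems unfolding positive_free_def by auto
  consider "n = 0" | "n = 1" | "2 \<le> n" by linarith
  then show ?case
  proof cases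
    case 1
    then obtain i j where I: "I = {i}" "J = {j}"
      using Suc.hyps(2) Suc.prems(3) by (metis One_nat_def card_1_singletonE)
    have "a i \<in> int_span J b" "b j \<in> int_span I a"
      using int_span_base[OF fin(1), of i a] int_span_base[OF fin(2), of j b] I Suc.prems(4) by auto
    then have "\<exists>c. a i = real_of_int (c j) * b j" "\<exists>c. b j = real_of_int (c i) * a i"
      unfolding int_span_def I by simp_all
    then obtain u v :: int where uv: "a i = u * b j" "b j = v * a i" by metis
    have pos: "0 < a i" "0 < b j" using Suc.prems I unfolding positive_free_def by auto
    have "b j = v * (u * b j)" using uv(2) unfolding uv(1) .
    then have "real_of_int (u * v) * b j = 1 * b j" by (simp add: ac_simps)
    then have "real_of_int (u * v) = 1" using pos by (metis less_irrefl mult_cancel_right)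
    then have "u * v = 1" by (metis of_int_eq_1_iff)
    moreover have "0 < u" using pos uv(1) by (simp add: zero_less_mult_iff)
    ultimately have "u = 1" by (simp add: zmult_eq_1_iff)
    then have "a ` I = b ` J" using uv(1) I by simp
    then show ?thesis by blast
  next
    case 2
    obtain i1 i2 where I: "I = {i1, i2}" "i1 \<noteq> i2"
      using Suc.hyps(2) 2 by (metis Suc_1 card_2_iff One_nat_def)
    obtain j1 j2 where J: "J = {j1, j2}" "j1 \<noteq> j2"
      using Suc.hyps(2) Suc.prems(3) 2 by (metis Suc_1 card_2_iff One_nat_def)
    have pos: "0 < a i1" "0 < a i2" using Suc.prems I unfolding positive_free_def by auto
    have "a i1 \<in> int_span J b" "a i2 \<in> int_span J b"
      using int_span_base[OF fin(1), of _ a] I Suc.prems(4) by auto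
    then obtain b1 where b1: "subtractions J b b1" "a i1 \<in> nat_span J b1"
      using eventually_in_nat_span[OF Suc.prems(2)] pos by blast
    have p1: "positive_free J b1" "int_span J b1 = int_span J b"
      using subtractions_preserve[OF b1(1) Suc.prems(2)] by auto
    then obtain b2 where b2: "subtractions J b1 b2" "a i2 \<in> nat_span J b2"
      using eventually_in_nat_span[OF p1(1)] pos \<open>a i2 \<in> int_span J b\<close> by blast
    have p2: "positive_free J b2" "int_span J b2 = int_span J b" "a i1 \<in> nat_span J b2"
      using subtractions_preserve[OF b2(1) p1(1)] p1 b1(2) by auto
    obtain x1 x2 :: nat where x: "a i1 = of_nat x1 * b2 j1 + of_nat x2 * b2 j2"
      using p2(3) J(2) unfolding nat_span_def J(1) by auto
    obtain y1 y2 :: nat where y: "a i2 = of_nat y1 * b2 j1 + of_nat y2 * b2 j2"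
      using b2(2) J(2) unfolding nat_span_def J(1) by auto
    obtain a' where "subtractions I a a'" "a' ` I = b2 ` J"
      using common_subtraction_two[OF _ J(2) I(2) _ _ x y] p2(1,2) Suc.prems(1,4) unfolding I J by auto
    moreover have "subtractions J b b2" using b1(1) b2(1) by simp
    ultimately show ?thesis by blast
  next
    case 3
    define S where "S = int_span J b"
    have Sa: "int_span I a = S" using Suc.prems(4) S_def by simp
    have "J \<noteq> {}" using Suc.hyps(2) Suc.prems(3) by auto
    then obtain j0 where j0: "j0 \<in> J" by blast
    define s where "s = b j0"
    obtain f where f: "additive_on S f" and fc: "\<forall>c. f (\<Sum>j\<in>J. of_int (c j) * b j) = c j0"
      using ex_coordinate[OF Suc.prems(2) j0] unfolding S_def by blast
    have s: "0 < s" "s \<in> S" "f s = 1"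
      using Suc.prems(2) j0 additive_on_base[OF fin(2) fc j0] int_span_base[OF fin(2) j0, of b]
      unfolding positive_free_def s_def S_def by auto
    \<comment> \<open>nonnegativity of \<open>s\<close> survives all later steps; it is what finally puts \<open>s - q1\<close> into the monoid
      of the common kernel family\<close>
    obtain a1 where a1: "subtractions I a a1" "s \<in> nat_span I a1"
      using eventually_in_nat_span[OF Suc.prems(1)] s(1,2) unfolding Sa by blast
    have p1: "positive_free I a1" "int_span I a1 = S"
      using subtractions_preserve[OF a1(1) Suc.prems(1)] Sa by auto
    obtain a2 where a2: "subtractions I a1 a2" "splits I f a2"
      using eventually_splits[OF _ f s(2,3) p1] Suc.hyps(2) 3 by auto
    have p2: "positive_free I a2" "int_span I a2 = S" "s \<in> nat_span I a2"
      using subtractions_preserve[OF a2(1) p1(1)] p1(2) a1(2) by auto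
    obtain h k where hk: "h \<in> I" "k \<in> I" "h \<noteq> k" and fhk: "f (a2 h) = 1" "f (a2 k) = - 1"
      "\<forall>i\<in>I - {h, k}. f (a2 i) = 0"
      using a2(2) unfolding splits_def by blast
    define I' where "I' = I - {h}"
    define J' where "J' = J - {j0}"
    have I: "I = insert h I'" "h \<notin> I'" "k \<in> I'" using hk unfolding I'_def by auto
    have J: "J = insert j0 J'" "j0 \<notin> J'" using j0 unfolding J'_def by auto
    define q where "q = a2 h"
    define y where "y = a2(k := a2 k + a2 h)"
    have a2y: "a2 = split_at h k q y"
      using hk unfolding split_at_def q_def y_def by (auto simp: fun_eq_iff)
    have q: "0 < q" "q < y k"
      using p2(1) hk unfolding q_def y_def positive_free_def by auto
    have free2: "positive_free (insert h I') (split_at h k q y)"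
      using p2(1) unfolding a2y I(1)[symmetric] .
    have f2: "additive_on (int_span (insert h I') (split_at h k q y)) f"
      using f p2(2) unfolding a2y[symmetric] I(1)[symmetric] by simp
    have fq: "f q = 1" "f (y k - q) = - 1" "\<forall>i\<in>I' - {k}. f (y i) = 0"
      using fhk unfolding q_def y_def I'_def by auto
    have y: "positive_free I' y" "int_span I' y = {x \<in> S. f x = 0}"
      using kernel_split[OF free2 I(2,3) f2 fq] p2(2) unfolding a2y[symmetric] I(1)[symmetric] by auto
    have b: "positive_free J' b" "int_span J' b = {x \<in> S. f x = 0}"
      using positive_free_subset[OF Suc.prems(2)] kernel_coordinate[OF fin(2) j0 fc]
      unfolding J'_def S_def by auto
    have "n = card I'" "card I' = card J'"
      using Suc.hyps(2) Suc.prems(3) fin hk(1) j0 unfolding I'_def J'_def by auto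
    then obtain y1 b1 where y1: "subtractions I' y y1" and b1: "subtractions J' b b1"
      and img: "y1 ` I' = b1 ` J'"
      using Suc.hyps(1)[OF _ y(1) b(1)] y(2) b(2) by auto
    have py1: "positive_free I' y1" "int_span I' y1 = int_span I' y"
      using subtractions_preserve[OF y1 y(1)] by auto
    have pb1: "positive_free J' b1" using subtractions_preserve[OF b1 b(1)] by auto
    obtain k1 q1 where k1: "k1 \<in> I'" "0 < q1" "q1 < y1 k1" "q - q1 \<in> int_span I' y"
      and lift: "subtractions (insert h I') (split_at h k q y) (split_at h k1 q1 y1)"
      using lift_subtractions[OF y1 I(2,3) q free2 y(1)] by blast
    define a3 where "a3 = split_at h k1 q1 y1"
    have a3: "subtractions I a2 a3" using lift unfolding a3_def a2y I(1)[symmetric] .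
    have p3: "positive_free I a3" "int_span I a3 = S" "s \<in> nat_span I a3"
      using subtractions_preserve[OF a3 p2(1)] p2(2,3) by auto
    have fin': "finite I'" using fin I by auto
    have fd: "f (x - z) = f x - f z" if "x \<in> S" "z \<in> S" for x z
      using f that unfolding additive_on_def by blast
    have qS: "q \<in> S" using int_span_base[OF fin(1) hk(1), of a2] p2(2) unfolding q_def by simp
    have y1S: "y1 i \<in> S \<and> f (y1 i) = 0" if "i \<in> I'" for i
      using int_span_base[OF fin' that, of y1] unfolding py1(2) y(2) by auto
    have "q - q1 \<in> S" "f (q - q1) = 0" using k1(4) unfolding y(2) by auto
    then have q1: "q1 \<in> S" "f q1 = 1"
      using int_span_diff[of q I a2 "q - q1"] fd[OF qS, of "q - q1"] qS fq(1) unfolding p2(2) by auto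
    \<comment> \<open>hence \<open>q1\<close> can be reached from \<open>s\<close> by subtracting members of the common kernel family\<close>
    have "s - q1 \<in> nat_span I' y1"
    proof (rule nat_span_split[where f = f])
      show "positive_free (insert h I') (split_at h k1 q1 y1)"
        using p3(1) unfolding a3_def I(1)[symmetric] .
      show "additive_on (int_span (insert h I') (split_at h k1 q1 y1)) f"
        using f p3(2) unfolding a3_def[symmetric] I(1)[symmetric] by simp
      show "s \<in> nat_span (insert h I') (split_at h k1 q1 y1)"
        using p3(3) unfolding a3_def I(1)[symmetric] .
      show "f (y1 k1 - q1) = - 1" using fd[of "y1 k1" q1] y1S[OF k1(1)] q1 by simp
    qed (use I k1 q1 s y1S in auto)
    then have sq: "s - q1 \<in> nat_span J' b1"
      using nat_span_cong_image[OF positive_free_inj[OF py1(1)] positive_free_inj[OF pb1] img] by blast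
    have "b1 j0 = s" using subtractions_outside[OF b1 J(2)] s_def by simp
    then have b1s: "b1 = b1(j0 := q1 + (s - q1))" by auto
    have fJ': "finite J'" "\<forall>j\<in>J'. 0 < b1 j" using pb1 unfolding positive_free_def by auto
    define b2 where "b2 = b1(j0 := q1)"
    have b2: "subtractions J b1 b2"
      using subtract_nat_span[OF fJ' J(2) k1(2) sq] b1s unfolding b2_def J(1)[symmetric] by simp
    obtain l where l: "l \<in> J'" "b1 l = y1 k1" using img k1(1) by (metis imageE image_eqI)
    define b3 where "b3 = b2(l := b2 l - b2 j0)"
    have lj: "l \<noteq> j0" using l J by auto
    have b3: "subtraction J b2 b3"
      unfolding b3_def using l lj j0 k1(3) J by (intro subtractionI) (auto simp: b2_def)
    have "b3 ` J = insert q1 (insert (y1 k1 - q1) (b1 ` (J' - {l})))"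
    proof -
      have "b3 ` J = b3 ` insert j0 (insert l (J' - {l}))" using J l by (simp add: insert_absorb)
      also have "\<dots> = insert (b3 j0) (insert (b3 l) (b3 ` (J' - {l})))" by (simp only: image_insert)
      also have "b3 ` (J' - {l}) = b1 ` (J' - {l})"
        using J unfolding b3_def b2_def by (intro image_cong) auto
      also have "b3 j0 = q1" using lj unfolding b3_def b2_def by auto
      also have "b3 l = y1 k1 - q1" using lj l unfolding b3_def b2_def by auto
      finally show ?thesis .
    qed
    moreover have "a3 ` I = insert q1 (insert (y1 k1 - q1) (y1 ` (I' - {k1})))"
    proof -
      have "k1 \<noteq> h" using k1 I by auto
      have "a3 ` I = a3 ` insert h (insert k1 (I' - {k1}))" using I k1 by (simp add: insert_absorb)
      also have "\<dots> = insert (a3 h) (insert (a3 k1) (a3 ` (I' - {k1})))" by (simp only: image_insert)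
      also have "a3 ` (I' - {k1}) = y1 ` (I' - {k1})"
        using I unfolding a3_def split_at_def by (intro image_cong) auto
      also have "a3 h = q1" unfolding a3_def split_at_def by simp
      also have "a3 k1 = y1 k1 - q1" using \<open>k1 \<noteq> h\<close> unfolding a3_def split_at_def by simp
      finally show ?thesis .
    qed
    moreover have "y1 ` (I' - {k1}) = b1 ` (J' - {l})"
    proof -
      have "y1 ` (I' - {k1}) = y1 ` I' - {y1 k1}"
        using inj_on_image_set_diff[OF positive_free_inj[OF py1(1)], of I' "{k1}"] k1(1) by auto
      moreover have "b1 ` (J' - {l}) = b1 ` J' - {b1 l}"
        using inj_on_image_set_diff[OF positive_free_inj[OF pb1], of J' "{l}"] l(1) by auto
      ultimately show ?thesis using img l by simp
    qed
    ultimately have "a3 ` I = b3 ` J" by simp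
    moreover have "subtractions I a a3" using a1(1) a2(1) a3 by simp
    moreover have "subtractions J b b1" using subtractions_mono[OF b1, of J] J(1) by blast
    then have "subtractions J b b3" using b2 b3 by (meson rtranclp_trans rtranclp.rtrancl_into_rtrancl)
    ultimately show ?thesis by blast
  qed
qed

section \<open>From families of coordinates to cones\<close>

text \<open>
  A lattice basis as a family, whose index set does not change under star subdivisions.
\<close>
definition basis_family :: "'a::real_vector set \<Rightarrow> 'i set \<Rightarrow> ('i \<Rightarrow> 'a) \<Rightarrow> bool" where
  "basis_family N I u \<longleftrightarrow> finite I \<and>
     (\<forall>c. (\<Sum>i\<in>I. c i *\<^sub>R u i) = 0 \<longrightarrow> (\<forall>i\<in>I. c i = 0)) \<and>
     (\<forall>x. \<exists>c. x = (\<Sum>i\<in>I. c i *\<^sub>R u i)) \<and>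
     N = {(\<Sum>i\<in>I. of_int (c i) *\<^sub>R u i) | c :: 'i \<Rightarrow> int. True}"

lemma basis_family_inj:
  assumes "basis_family N I u"
  shows "inj_on u I"
proof (rule inj_onI, rule ccontr)
  fix i j assume ij: "i \<in> I" "j \<in> I" "u i = u j" "i \<noteq> j"
  have fin: "finite I" and ind: "\<And>c. (\<Sum>i\<in>I. c i *\<^sub>R u i) = 0 \<Longrightarrow> \<forall>i\<in>I. c i = 0"
    using assms unfolding basis_family_def by auto
  let ?c = "\<lambda>l. if l = i then 1 else if l = j then - 1 else 0 :: real"
  have "(\<Sum>l\<in>I. ?c l *\<^sub>R u l) = (\<Sum>l\<in>I. (if l = i then u l else 0) - (if l = j then u l else 0))"
    using ij by (intro sum.cong) auto
  also have "\<dots> = 0" using fin ij by (simp add: sum_subtractf)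
  finally have "(\<Sum>l\<in>I. ?c l *\<^sub>R u l) = 0" .
  then have "?c i = 0" using ind[of ?c] ij(1) by blast
  then show False by simp
qed

lemma basis_family_id:
  assumes "lattice_basis N B"
  shows "basis_family N B id"
proof -
  have fin: "finite B" and ind: "independent B" and span: "span B = UNIV"
    and N: "N = {(\<Sum>b\<in>B. of_int (c b) *\<^sub>R b) | c :: 'a \<Rightarrow> int. True}"
    using assms unfolding lattice_basis_def by auto
  have "\<forall>b\<in>B. c b = 0" if "(\<Sum>b\<in>B. c b *\<^sub>R b) = 0" for c
    using independentD[OF ind fin subset_refl that] by blast
  moreover have "\<exists>c. x = (\<Sum>b\<in>B. c b *\<^sub>R b)" for x
  proof -
    have "x \<in> range (\<lambda>c. \<Sum>b\<in>B. c b *\<^sub>R b)" using span span_finite[OF fin] by simp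
    then show ?thesis by blast
  qed
  ultimately show ?thesis using fin N unfolding basis_family_def by simp
qed

lemma lattice_basis_image:
  assumes "basis_family N I u"
  shows "lattice_basis N (u ` I)"
proof -
  note inj = basis_family_inj[OF assms]
  have fin: "finite I" and ind: "\<And>c. (\<Sum>i\<in>I. c i *\<^sub>R u i) = 0 \<Longrightarrow> \<forall>i\<in>I. c i = 0"
    and span: "\<And>x. \<exists>c. x = (\<Sum>i\<in>I. c i *\<^sub>R u i)"
    and N: "N = {(\<Sum>i\<in>I. of_int (c i) *\<^sub>R u i) | c :: 'b \<Rightarrow> int. True}"
    using assms unfolding basis_family_def by auto
  have eq: "(\<Sum>w\<in>u ` I. c w *\<^sub>R w) = (\<Sum>i\<in>I. c (u i) *\<^sub>R u i)" for c
    using inj by (simp add: sum.reindex)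
  have reindex: "(\<Sum>i\<in>I. c i *\<^sub>R u i) = (\<Sum>w\<in>u ` I. c (inv_into I u w) *\<^sub>R w)" for c
    unfolding eq using inj by (intro sum.cong) auto
  have "independent (u ` I)"
  proof (rule independent_if_scalars_zero)
    show "finite (u ` I)" using fin by simp
    fix c w assume "(\<Sum>w\<in>u ` I. c w *\<^sub>R w) = 0" "w \<in> u ` I"
    then show "c w = 0" using ind[of "\<lambda>i. c (u i)"] unfolding eq by auto
  qed
  moreover have "span (u ` I) = UNIV"
  proof -
    have "x \<in> span (u ` I)" for x
    proof -
      obtain c where "x = (\<Sum>i\<in>I. c i *\<^sub>R u i)" using span by blast
      then show ?thesis by (auto intro!: span_sum span_scale intro: span_base)
    qed
    then show ?thesis by auto
  qed
  moreover have "N = {(\<Sum>w\<in>u ` I. of_int (c w) *\<^sub>R w) | c :: 'a \<Rightarrow> int. True}"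
    (is "N = ?R")
  proof
    show "N \<subseteq> ?R"
    proof
      fix x assume "x \<in> N"
      then obtain c :: "'b \<Rightarrow> int" where "x = (\<Sum>i\<in>I. of_int (c i) *\<^sub>R u i)" unfolding N by blast
      then have "x = (\<Sum>w\<in>u ` I. of_int (c (inv_into I u w)) *\<^sub>R w)"
        using reindex[of "\<lambda>i. of_int (c i)"] by simp
      then show "x \<in> ?R" by (intro CollectI exI[of _ "\<lambda>w. c (inv_into I u w)"]) simp
    qed
    show "?R \<subseteq> N"
    proof
      fix x assume "x \<in> ?R"
      then obtain c :: "'a \<Rightarrow> int" where "x = (\<Sum>w\<in>u ` I. of_int (c w) *\<^sub>R w)" by blast
      then have "x = (\<Sum>i\<in>I. of_int (c (u i)) *\<^sub>R u i)" unfolding eq .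
      then show "x \<in> N" unfolding N by (intro CollectI exI[of _ "\<lambda>i. c (u i)"]) simp
    qed
  qed
  ultimately show ?thesis using fin unfolding lattice_basis_def by simp
qed

definition coordinates :: "'a::real_vector set \<Rightarrow> 'a \<Rightarrow> 'i set \<Rightarrow> ('i \<Rightarrow> 'a) \<Rightarrow> ('i \<Rightarrow> real) \<Rightarrow> bool" where
  "coordinates N v I u a \<longleftrightarrow> basis_family N I u \<and> positive_free I a \<and> v = (\<Sum>i\<in>I. a i *\<^sub>R u i)"

lemma sum_scale_subtract:
  fixes u :: "'i \<Rightarrow> 'a::real_vector"
  assumes "finite I" "i \<in> I" "j \<in> I" "i \<noteq> j"
  shows "(\<Sum>l\<in>I. c l *\<^sub>R (u(j := u j + u i)) l) = (\<Sum>l\<in>I. (c(i := c i + c j)) l *\<^sub>R u l)"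
proof -
  have "(\<Sum>l\<in>I. c l *\<^sub>R (u(j := u j + u i)) l) = (\<Sum>l\<in>I. c l *\<^sub>R u l) + c j *\<^sub>R u i"
    by (subst sum_update[where F = "\<lambda>l x. c l *\<^sub>R x", OF assms(1,3)]) (simp add: algebra_simps)
  moreover have "(\<Sum>l\<in>I. (c(i := c i + c j)) l *\<^sub>R u l) = (\<Sum>l\<in>I. c l *\<^sub>R u l) + c j *\<^sub>R u i"
    by (subst sum_update[where F = "\<lambda>l x. x *\<^sub>R u l", OF assms(1,2)]) (simp add: algebra_simps)
  ultimately show ?thesis by simp
qed

lemma basis_family_add:
  fixes u :: "'i \<Rightarrow> 'a::real_vector"
  assumes "basis_family N I u" "i \<in> I" "j \<in> I" "i \<noteq> j"
  shows "basis_family N I (u(j := u j + u i))"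
proof -
  have fin: "finite I" and ind: "\<And>c. (\<Sum>i\<in>I. c i *\<^sub>R u i) = 0 \<Longrightarrow> \<forall>i\<in>I. c i = 0"
    and span: "\<And>x. \<exists>c. x = (\<Sum>i\<in>I. c i *\<^sub>R u i)"
    and N: "N = {(\<Sum>i\<in>I. of_int (c i) *\<^sub>R u i) | c :: 'i \<Rightarrow> int. True}"
    using assms unfolding basis_family_def by auto
  let ?u = "u(j := u j + u i)"
  note eq = sum_scale_subtract[OF fin assms(2-4), of _ u]
  have eq': "(\<Sum>l\<in>I. c l *\<^sub>R u l) = (\<Sum>l\<in>I. (c(i := c i - c j)) l *\<^sub>R ?u l)" for c
  proof -
    have "(c(i := c i - c j))(i := (c(i := c i - c j)) i + (c(i := c i - c j)) j) = c"
      using assms(4) by auto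
    then show ?thesis using eq[of "c(i := c i - c j)"] by (simp only:)
  qed
  have ieq: "(\<Sum>l\<in>I. of_int (c l) *\<^sub>R ?u l) = (\<Sum>l\<in>I. of_int ((c(i := c i + c j)) l) *\<^sub>R u l)"
    for c :: "'i \<Rightarrow> int" unfolding eq by (rule sum.cong) auto
  have ieq': "(\<Sum>l\<in>I. of_int (c l) *\<^sub>R u l) = (\<Sum>l\<in>I. of_int ((c(i := c i - c j)) l) *\<^sub>R ?u l)"
    for c :: "'i \<Rightarrow> int"
  proof -
    have "(c(i := c i - c j))(i := (c(i := c i - c j)) i + (c(i := c i - c j)) j) = c"
      using assms(4) by auto
    then show ?thesis using ieq[of "c(i := c i - c j)"] by (simp only:)
  qed
  show ?thesis
    unfolding basis_family_def
  proof (intro conjI allI impI fin)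
    fix c assume "(\<Sum>l\<in>I. c l *\<^sub>R ?u l) = 0"
    then have "\<forall>l\<in>I. (c(i := c i + c j)) l = 0" unfolding eq by (rule ind)
    then show "\<forall>l\<in>I. c l = 0" using assms(2-4) by (metis add.right_neutral fun_upd_apply)
  next
    fix x obtain c where "x = (\<Sum>i\<in>I. c i *\<^sub>R u i)" using span by blast
    then show "\<exists>c. x = (\<Sum>l\<in>I. c l *\<^sub>R ?u l)" unfolding eq' by blast
  next
    show "N = {(\<Sum>l\<in>I. of_int (c l) *\<^sub>R ?u l) | c :: 'i \<Rightarrow> int. True}"
      unfolding N using ieq ieq' by (intro set_eqI iffI; clarify; blast)
  qed
qed

lemma coordinates_in_cone:
  assumes "coordinates N v I u a"
  shows "v \<in> cone_spanned_by (u ` I)"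
proof -
  have inj: "inj_on u I" and v: "v = (\<Sum>i\<in>I. a i *\<^sub>R u i)" and pos: "\<forall>i\<in>I. 0 < a i"
    using assms basis_family_inj unfolding coordinates_def positive_free_def by auto
  have "v = (\<Sum>w\<in>u ` I. a (inv_into I u w) *\<^sub>R w)"
    unfolding v using inj by (subst sum.reindex) (auto intro!: sum.cong)
  moreover have "\<forall>w\<in>u ` I. 0 \<le> a (inv_into I u w)" using pos inj by (auto simp: less_imp_le)
  ultimately show ?thesis unfolding cone_spanned_by_def
    by (intro CollectI exI[of _ "\<lambda>w. a (inv_into I u w)"]) simp
qed

lemma subtraction_star_subdivision:
  assumes "coordinates N v I u a" "subtraction I a a'"
  shows "\<exists>u'. coordinates N v I u' a' \<and>
     star_subdivision N v (cone_spanned_by (u ` I)) (cone_spanned_by (u' ` I))"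
proof -
  obtain i j where ij: "i \<in> I" "j \<in> I" "a j < a i" and a': "a' = a(i := a i - a j)"
    using assms(2) unfolding subtraction_def by blast
  have ne: "i \<noteq> j" using ij by auto
  have bas: "basis_family N I u" and pf: "positive_free I a" and v: "v = (\<Sum>i\<in>I. a i *\<^sub>R u i)"
    using assms(1) unfolding coordinates_def by auto
  have fin: "finite I" using pf unfolding positive_free_def by simp
  define u' where "u' = u(j := u j + u i)"
  have "(\<Sum>l\<in>I. a' l *\<^sub>R u' l) = (\<Sum>l\<in>I. (a'(i := a' i + a' j)) l *\<^sub>R u l)"
    unfolding u'_def by (rule sum_scale_subtract[OF fin ij(1,2) ne])
  also have "a'(i := a' i + a' j) = a" using ne unfolding a' by auto
  finally have c': "coordinates N v I u' a'"
    using basis_family_add[OF bas ij(1,2) ne] subtraction_preserves(1)[OF pf assms(2)] v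
    unfolding coordinates_def u'_def by simp
  have inj: "inj_on u I" by (rule basis_family_inj[OF bas])
  have "u' ` I = u' ` insert j (I - {j})" using ij by (simp add: insert_absorb)
  also have "\<dots> = insert (u j + u i) (u ` (I - {j}))" unfolding u'_def by auto
  also have "u ` (I - {j}) = u ` I - {u j}" using inj ij by (auto simp: inj_on_def)
  finally have img: "u' ` I = insert (u j + u i) (u ` I - {u j})" .
  have "u j \<noteq> u i" using inj ij ne by (auto simp: inj_on_def)
  then have "star_subdivision N v (cone_spanned_by (u ` I)) (cone_spanned_by (u' ` I))"
    unfolding star_subdivision_def using lattice_basis_image[OF bas] coordinates_in_cone[OF assms(1)]
      coordinates_in_cone[OF c'] ij img by (metis image_eqI)
  then show ?thesis using c' by blast
qed

lemma subtractions_star_subdivisions: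
  assumes "subtractions I a a'" "coordinates N v I u a"
  shows "\<exists>u'. coordinates N v I u' a' \<and>
     (star_subdivision N v)\<^sup>*\<^sup>* (cone_spanned_by (u ` I)) (cone_spanned_by (u' ` I))"
  using assms(1)
proof (induction rule: rtranclp_induct)
  case base
  then show ?case using assms(2) by blast
next
  case (step b c)
  then obtain u1 where 1: "coordinates N v I u1 b"
    "(star_subdivision N v)\<^sup>*\<^sup>* (cone_spanned_by (u ` I)) (cone_spanned_by (u1 ` I))" by blast
  from subtraction_star_subdivision[OF 1(1) step(2)] show ?case
    using 1(2) by (meson rtranclp.rtrancl_into_rtrancl)
qed

lemma change_of_basis:
  assumes "basis_family N I u" "basis_family N J t"
  shows "\<exists>C :: 'j \<Rightarrow> 'i \<Rightarrow> int. \<forall>j\<in>J. t j = (\<Sum>i\<in>I. of_int (C j i) *\<^sub>R u i)"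
proof -
  have "\<exists>c :: 'i \<Rightarrow> int. t j = (\<Sum>i\<in>I. of_int (c i) *\<^sub>R u i)" if j: "j \<in> J" for j
  proof -
    have fin: "finite J" and N: "N = {(\<Sum>j\<in>J. of_int (c j) *\<^sub>R t j) | c :: 'j \<Rightarrow> int. True}"
      and N': "N = {(\<Sum>i\<in>I. of_int (c i) *\<^sub>R u i) | c :: 'i \<Rightarrow> int. True}"
      using assms unfolding basis_family_def by auto
    have "(\<Sum>l\<in>J. of_int (if l = j then 1 else 0) *\<^sub>R t l) = (\<Sum>l\<in>J. if l = j then t l else 0)"
      by (rule sum.cong) auto
    then have "t j = (\<Sum>l\<in>J. of_int (if l = j then 1 else 0) *\<^sub>R t l)" using fin j by simp
    then have "t j \<in> N" unfolding N by (intro CollectI exI[of _ "\<lambda>l. if l = j then 1 else 0"]) simp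
    then show ?thesis unfolding N' by blast
  qed
  then show ?thesis by metis
qed

lemma basis_family_coeff_unique:
  assumes "basis_family N I u" "(\<Sum>i\<in>I. c i *\<^sub>R u i) = (\<Sum>i\<in>I. d i *\<^sub>R u i)" "i \<in> I"
  shows "c i = d i"
proof -
  have "(\<Sum>i\<in>I. (c i - d i) *\<^sub>R u i) = 0" using assms(2) by (simp add: sum_subtractf algebra_simps)
  then have "c i - d i = 0" using assms(1,3) unfolding basis_family_def by fast
  then show ?thesis by simp
qed

lemma coordinates_transform:
  fixes C :: "'j \<Rightarrow> 'i \<Rightarrow> int"
  assumes "basis_family N I u" "\<forall>j\<in>J. t j = (\<Sum>i\<in>I. of_int (C j i) *\<^sub>R u i)"
    and "(\<Sum>i\<in>I. a i *\<^sub>R u i) = (\<Sum>j\<in>J. b j *\<^sub>R t j)" "i \<in> I"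
  shows "a i = (\<Sum>j\<in>J. of_int (C j i) * b j)"
proof -
  have "(\<Sum>j\<in>J. b j *\<^sub>R t j) = (\<Sum>j\<in>J. \<Sum>i\<in>I. (of_int (C j i) * b j) *\<^sub>R u i)"
    using assms(2) by (intro sum.cong) (auto simp: scaleR_sum_right mult.commute)
  also have "\<dots> = (\<Sum>i\<in>I. (\<Sum>j\<in>J. of_int (C j i) * b j) *\<^sub>R u i)"
    by (subst sum.swap) (simp add: scaleR_sum_left)
  finally show ?thesis using basis_family_coeff_unique[OF assms(1) _ assms(4)] assms(3) by simp
qed

lemma int_span_coordinates_subset:
  assumes "coordinates N v I u a" "coordinates N v J t b"
  shows "int_span I a \<subseteq> int_span J b"
proof -
  obtain C :: "'c \<Rightarrow> 'b \<Rightarrow> int" where C: "\<forall>j\<in>J. t j = (\<Sum>i\<in>I. of_int (C j i) *\<^sub>R u i)"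
    using change_of_basis[of N I u J t] assms unfolding coordinates_def by blast
  have bas: "basis_family N I u" using assms(1) unfolding coordinates_def by simp
  have sums: "(\<Sum>i\<in>I. a i *\<^sub>R u i) = (\<Sum>j\<in>J. b j *\<^sub>R t j)"
    using assms unfolding coordinates_def by metis
  have ai: "a i = (\<Sum>j\<in>J. of_int (C j i) * b j)" if "i \<in> I" for i
    by (rule coordinates_transform[OF bas C sums that])
  show ?thesis
  proof
    fix x assume "x \<in> int_span I a"
    then obtain c where "x = (\<Sum>i\<in>I. of_int (c i) * a i)" unfolding int_span_def by blast
    also have "\<dots> = (\<Sum>i\<in>I. of_int (c i) * (\<Sum>j\<in>J. of_int (C j i) * b j))"
      by (rule sum.cong) (simp_all only: ai)
    also have "\<dots> = (\<Sum>i\<in>I. \<Sum>j\<in>J. of_int (c i * C j i) * b j)"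
      by (simp add: sum_distrib_left mult.assoc)
    also have "\<dots> = (\<Sum>j\<in>J. of_int (\<Sum>i\<in>I. c i * C j i) * b j)"
      by (subst sum.swap) (simp add: sum_distrib_right)
    finally show "x \<in> int_span J b" using int_spanI[of "\<lambda>j. \<Sum>i\<in>I. c i * C j i" b J] by simp
  qed
qed

text \<open>
  Write \<open>t j\<close> in the basis \<open>u\<close> with integer coefficients \<open>C j i\<close>.  These also express the coordinates \<open>a\<close> by the
  coordinates \<open>b\<close>.  As the latter are independent and every \<open>a i\<close> is one of them, the matrix \<open>C\<close> is a
  permutation matrix.
\<close>
lemma coordinates_determine_basis:
  assumes "coordinates N v I u a" "coordinates N v J t b" "a ` I = b ` J"
  shows "t ` J \<subseteq> u ` I"
proof
  have pfb: "positive_free J b" and fin: "finite I" "finite J"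
    using assms unfolding coordinates_def positive_free_def by auto
  obtain C :: "'c \<Rightarrow> 'b \<Rightarrow> int" where C: "\<forall>j\<in>J. t j = (\<Sum>i\<in>I. of_int (C j i) *\<^sub>R u i)"
    using change_of_basis[of N I u J t] assms unfolding coordinates_def by blast
  have bas: "basis_family N I u" using assms(1) unfolding coordinates_def by simp
  have sums: "(\<Sum>i\<in>I. a i *\<^sub>R u i) = (\<Sum>j\<in>J. b j *\<^sub>R t j)"
    using assms unfolding coordinates_def by metis
  fix w assume "w \<in> t ` J"
  then obtain j where j: "j \<in> J" "w = t j" by blast
  then obtain i where i: "i \<in> I" "a i = b j" using assms(3) by (metis imageE image_eqI)
  have "C j l = (if l = i then 1 else 0)" if l: "l \<in> I" for l
  proof -
    obtain k where k: "k \<in> J" "a l = b k" using assms(3) l by (metis imageE image_eqI)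
    have "(\<Sum>m\<in>J. of_int (C m l) * b m) = a l"
      by (rule coordinates_transform[OF bas C sums l, symmetric])
    also have "a l = (\<Sum>m\<in>J. if m = k then b m else 0)" using k fin by simp
    also have "\<dots> = (\<Sum>m\<in>J. of_int (if m = k then 1 else 0) * b m)" by (rule sum.cong) auto
    finally have "C j l = (if j = k then 1 else 0)"
      by (rule positive_free_coeff_unique[OF pfb _ j(1)])
    moreover have "j = k \<longleftrightarrow> l = i"
      using positive_free_inj[OF pfb] assms(1) positive_free_inj[of I a] i j k l
      unfolding coordinates_def by (metis inj_onD)
    ultimately show ?thesis by simp
  qed
  then have "w = (\<Sum>l\<in>I. of_int (if l = i then 1 else 0) *\<^sub>R u l)"
    using C j by (auto intro!: sum.cong)
  also have "\<dots> = (\<Sum>l\<in>I. if l = i then u l else 0)" by (rule sum.cong) auto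
  also have "\<dots> = u i" using fin i by simp
  finally show "w \<in> u ` I" using i by blast
qed

text \<open>
  The coordinates in two lattice bases are related by mutually inverse integer matrices \<open>C\<close> and \<open>D\<close>, which
  carry an integer relation in one basis to one in the other.
\<close>
lemma rational_independence_coordinates:
  assumes "rationally_independent_coords N v" "basis_family N I u" "v = (\<Sum>i\<in>I. a i *\<^sub>R u i)"
    and "(\<Sum>i\<in>I. of_int (m i) * a i) = 0" "i \<in> I"
  shows "m i = 0"
proof -
  obtain B where B: "lattice_basis N B" and
    ind: "\<And>q :: 'a \<Rightarrow> rat. (\<Sum>b\<in>B. of_rat (q b) * representation B v b) = 0 \<Longrightarrow> \<forall>b\<in>B. q b = 0"
    using assms(1) unfolding rationally_independent_coords_def by blast
  have Bf: "basis_family N B id" by (rule basis_family_id[OF B])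
  have iB: "independent B" "span B = UNIV" "finite B" using B unfolding lattice_basis_def by auto
  have v: "(\<Sum>b\<in>B. representation B v b *\<^sub>R id b) = v"
    using sum_representation_eq[OF iB(1) _ iB(3) subset_refl, of v] iB(2) by simp
  obtain D :: "'a \<Rightarrow> 'b \<Rightarrow> int" where D: "\<forall>b\<in>B. id b = (\<Sum>i\<in>I. of_int (D b i) *\<^sub>R u i)"
    using change_of_basis[OF assms(2) Bf] by blast
  obtain C :: "'b \<Rightarrow> 'a \<Rightarrow> int" where C: "\<forall>i\<in>I. u i = (\<Sum>b\<in>B. of_int (C i b) *\<^sub>R id b)"
    using change_of_basis[OF Bf assms(2)] by blast
  have a: "a l = (\<Sum>b\<in>B. of_int (D b l) * representation B v b)" if "l \<in> I" for l
    using coordinates_transform[OF assms(2) D _ that] v assms(3) by simp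
  have "0 = (\<Sum>l\<in>I. of_int (m l) * a l)" by (rule assms(4)[symmetric])
  also have "\<dots> = (\<Sum>l\<in>I. of_int (m l) * (\<Sum>b\<in>B. of_int (D b l) * representation B v b))"
    by (rule sum.cong) (simp_all only: a)
  also have "\<dots> = (\<Sum>l\<in>I. \<Sum>b\<in>B. of_int (m l * D b l) * representation B v b)"
    by (simp add: sum_distrib_left mult.assoc)
  also have "\<dots> = (\<Sum>b\<in>B. of_rat (of_int (\<Sum>l\<in>I. m l * D b l)) * representation B v b)"
    by (subst sum.swap) (simp add: sum_distrib_right of_rat_sum of_rat_mult)
  finally have "\<forall>b\<in>B. rat_of_int (\<Sum>l\<in>I. m l * D b l) = 0" using ind by metis
  then have z: "(\<Sum>l\<in>I. m l * D b l) = 0" if "b \<in> B" for b using that of_int_eq_0_iff by blast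
  have CD: "(if l = i then 1 else 0) = (\<Sum>b\<in>B. C i b * D b l)" if l: "l \<in> I" for l
  proof -
    have fin: "finite I" using assms(2) unfolding basis_family_def by simp
    have "(\<Sum>l\<in>I. (if l = i then 1 else 0) *\<^sub>R u l) = (\<Sum>l\<in>I. if l = i then u l else 0)"
      by (rule sum.cong) auto
    also have "\<dots> = u i" using fin assms(5) by simp
    also have "\<dots> = (\<Sum>b\<in>B. of_int (C i b) *\<^sub>R id b)" using C assms(5) by blast
    finally have "(if l = i then 1 else 0) = (\<Sum>b\<in>B. of_int (D b l) * real_of_int (C i b))"
      using coordinates_transform[OF assms(2) D _ l, of "\<lambda>l. if l = i then 1 else 0"] by simp
    also have "\<dots> = of_int (\<Sum>b\<in>B. C i b * D b l)" by (simp add: mult.commute)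
    finally show ?thesis by (metis of_int_eq_iff of_int_0 of_int_1)
  qed
  have fin: "finite I" using assms(2) unfolding basis_family_def by simp
  have "m i = (\<Sum>l\<in>I. m l * (if l = i then 1 else 0))"
    using fin assms(5) by (simp add: if_distrib cong: if_cong)
  also have "\<dots> = (\<Sum>l\<in>I. m l * (\<Sum>b\<in>B. C i b * D b l))"
    by (rule sum.cong) (simp_all only: CD)
  also have "\<dots> = (\<Sum>l\<in>I. \<Sum>b\<in>B. C i b * (m l * D b l))"
    by (simp add: sum_distrib_left mult.left_commute)
  also have "\<dots> = (\<Sum>b\<in>B. C i b * (\<Sum>l\<in>I. m l * D b l))"
    by (subst sum.swap) (simp add: sum_distrib_left)
  also have "\<dots> = 0" using z by simp
  finally show ?thesis .
qed

text \<open>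
  A cone spanned by a proper part of a lattice basis would give \<open>v\<close> a vanishing coordinate.
\<close>
lemma nonsingular_cone_coordinates:
  assumes "nonsingular_cone N \<sigma>" "v \<in> \<sigma>" "rationally_independent_coords N v"
  shows "\<exists>B a. coordinates N v B id a \<and> \<sigma> = cone_spanned_by B"
proof -
  obtain B W where B: "lattice_basis N B" "W \<subseteq> B" "\<sigma> = cone_spanned_by W"
    using assms(1) unfolding nonsingular_cone_def by blast
  obtain c where c: "v = (\<Sum>w\<in>W. c w *\<^sub>R w)" "\<forall>w\<in>W. 0 \<le> c w"
    using assms(2) unfolding B(3) cone_spanned_by_def by blast
  define a where "a b = (if b \<in> W then c b else 0)" for b
  have bas: "basis_family N B id" by (rule basis_family_id[OF B(1)])
  have fin: "finite B" using B unfolding lattice_basis_def by simp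
  have v: "v = (\<Sum>b\<in>B. a b *\<^sub>R id b)"
    unfolding c(1) a_def using B(2) fin by (intro sum.mono_neutral_cong_left) auto
  note ind = rational_independence_coordinates[OF assms(3) bas v]
  have "a b \<noteq> 0" if b: "b \<in> B" for b
  proof
    assume "a b = 0"
    then have "(\<Sum>l\<in>B. of_int (if l = b then 1 else 0) * a l) = 0" by (intro sum.neutral) auto
    from ind[OF this b] show False by simp
  qed
  then have "W = B" using B(2) unfolding a_def by (meson subsetI subset_antisym)
  moreover have "0 \<le> a b" for b using c(2) unfolding a_def by simp
  ultimately have pos: "\<forall>b\<in>B. 0 < a b" using \<open>\<And>b. b \<in> B \<Longrightarrow> a b \<noteq> 0\<close> by (metis less_le)
  have "positive_free B a" unfolding positive_free_def using fin pos ind by blast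
  then show ?thesis using bas v B(3) \<open>W = B\<close> unfolding coordinates_def by blast
qed

lemma card_lattice_basis:
  assumes "lattice_basis N B" "lattice_basis N B'"
  shows "card B = card B'"
proof -
  have "card B = dim (UNIV :: 'a set)" "card B' = dim (UNIV :: 'a set)"
    using assms dim_eq_card[of B UNIV] dim_eq_card[of B' UNIV] unfolding lattice_basis_def by auto
  then show ?thesis by simp
qed

theorem theorem0p2:
  fixes N \<sigma> \<tau> :: "'a::real_vector set" and v :: 'a
  assumes "full_lattice N"
    and "nonsingular_cone N \<sigma>"
    and "nonsingular_cone N \<tau>"
    and "v \<in> \<sigma> \<inter> \<tau>"
    and "rationally_independent_coords N v"
  shows "\<exists>\<rho>. nonsingular_cone N \<rho> \<and>
           (star_subdivision N v)\<^sup>*\<^sup>* \<sigma> \<rho> \<and>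
           (star_subdivision N v)\<^sup>*\<^sup>* \<tau> \<rho>"
proof -
  obtain I a where I: "coordinates N v I id a" "\<sigma> = cone_spanned_by I"
    using nonsingular_cone_coordinates assms by blast
  obtain J b where J: "coordinates N v J id b" "\<tau> = cone_spanned_by J"
    using nonsingular_cone_coordinates assms by blast
  have "card I = card J"
    using card_lattice_basis[of N I J] lattice_basis_image[of N I id] lattice_basis_image[of N J id]
      I(1) J(1) unfolding coordinates_def by simp
  moreover have "int_span I a = int_span J b"
    using int_span_coordinates_subset[OF I(1) J(1)] int_span_coordinates_subset[OF J(1) I(1)] by blast
  ultimately obtain a' b' where ab: "subtractions I a a'" "subtractions J b b'" "a' ` I = b' ` J"
    using common_subtraction[of I a J b] I(1) J(1) unfolding coordinates_def by blast
  obtain u where u: "coordinates N v I u a'" "(star_subdivision N v)\<^sup>*\<^sup>* \<sigma> (cone_spanned_by (u ` I))"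
    using subtractions_star_subdivisions[OF ab(1) I(1)] I(2) by auto
  obtain t where t: "coordinates N v J t b'" "(star_subdivision N v)\<^sup>*\<^sup>* \<tau> (cone_spanned_by (t ` J))"
    using subtractions_star_subdivisions[OF ab(2) J(1)] J(2) by auto
  have "u ` I = t ` J"
    using coordinates_determine_basis[OF u(1) t(1) ab(3)] coordinates_determine_basis[OF t(1) u(1) ab(3)[symmetric]]
    by blast
  moreover have "nonsingular_cone N (cone_spanned_by (u ` I))"
    using lattice_basis_image[of N I u] u(1) unfolding coordinates_def nonsingular_cone_def by blast
  ultimately show ?thesis using u(2) t(2) by metis
qed

end
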